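(* Let $X$ be a topological space and let $\mathcal P$ be either the system of all bounded subsets of $X$ or the system of all $\mathcal K$-countably-determined subsets of $X$. If $X$ is $\beta$-unfavorable in the $G_{\mathcal P}$-game, then $X$ is a $\beta-v$-unfavorable space.
   Context: For a topological space $X$, $C_p(X)$ denotes the space of all continuous functions $X\to\mathbb R$ with the topology of pointwise convergence. Powers $\mathbb R^S$ carry the product topology. A set $A$ in a topological space $X$ is bounded if for any continuous function $f:X\to\mathbb R$ the set $f(A)=\{f(a):a\in A\}$ is bounded. For a topological space $T$ let $\mathcal K(T)$ be the collection of all compact subsets of $T$. $T$ is $\mathcal K$-countably-determined if there exist a subset $S$ of the topological space $\mathbb N^{\mathbb N}$ and a mapping $\varphi:S\to\mathcal K(T)$ such that for every open set $U\subseteq T$ the set $\{s\in S:\varphi(s)\subseteq U\}$ is open in $S$, and $T=\bigcup_{s\in S}\varphi(s)$. A subset of $X$ is $\mathcal K$-countably-determined if it is so with the subspace topology. The $G_{\mathcal P}$-game. Let $\mathcal P$ be a system of subsets of a topological space $X$. Two players $\alpha$ and $\beta$ play on $X$ as follows. The first move of $\beta$ is a nonempty open set $U_0\subseteq X$; the first move of $\alpha$ is a nonempty open set $V_1\subseteq U_0$ together with a set $P_1\in\mathcal P$. Then $\beta$ chooses a nonempty open set $U_1\subseteq V_1$, and $\alpha$ chooses a nonempty open set $V_2\subseteq U_1$ and a set $P_2\in\mathcal P$, and so on. Player $\alpha$ wins if $\left(\bigcap_{n=1}^{\infty}V_n\right)\cap\overline{\bigcup_{n=1}^{\infty}P_n}\neq\emptyset$;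 otherwise $\beta$ wins. $X$ is $\beta$-unfavorable in the $G_{\mathcal P}$-game if $\beta$ has no winning strategy in this game. Valdivia compacts. The support of a function $z:S\to\mathbb R$ is $\mathrm{supp}\,z=\{s\in S: z(s)\neq 0\}$. A compact space is a Valdivia compact if it is homeomorphic to a compact set $Z\subseteq\mathbb R^S$ (for some set $S$) such that $\{z\in Z: |\mathrm{supp}\,z|\le\aleph_0\}$ is dense in $Z$. $\beta-v$-unfavorable spaces. For a system $\mathcal P$ of subsets of $X$ consider the conditions: $(v_1)$ $\mathcal P$ is closed with respect to finite unions; $(v_2)$ for every set $E\in\mathcal P$ and every compact $Y\subseteq C_p(X)$, the compact $\varphi(Y)$ is a Valdivia compact, where $\varphi:C_p(X)\to C_p(E)$, $\varphi(y)=y|_E$. A topological space $X$ is $\beta-v$-unfavorable if there is some system $\mathcal P$ of subsets of $X$ satisfying $(v_1)$ and $(v_2)$ such that $\beta$ has no winning strategy in the $G_{\mathcal P}$-game on $X$. *)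

theory Defs
  imports "HOL-Analysis.Analysis"
begin

abbreviation real_power :: "'s set \<Rightarrow> ('s \<Rightarrow> real) topology"
  where "real_power S \<equiv> product_topology (\<lambda>_. euclideanreal) S"

text \<open>The points of \<open>Cp_space X\<close> are the continuous functions that are \<^const>\<open>undefined\<close> outside
  \<open>topspace X\<close> (the extensionality built into \<^const>\<open>product_topology\<close>), so that every continuous
  function on \<open>X\<close> has exactly one representative; restriction to a subset is \<^const>\<open>restrict\<close>.\<close>

definition Cp_space :: "'a topology \<Rightarrow> ('a \<Rightarrow> real) topology"
  where "Cp_space X =
    subtopology (real_power (topspace X)) {f. continuous_map X euclideanreal f}"

definition restriction_map :: "'a set \<Rightarrow> ('a \<Rightarrow> real) \<Rightarrow> ('a \<Rightarrow> real)"
  where "restriction_map E y = restrict y E"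


definition bounded_subset :: "'a topology \<Rightarrow> 'a set \<Rightarrow> bool"
  where "bounded_subset X A \<longleftrightarrow> A \<subseteq> topspace X \<and>
    (\<forall>f. continuous_map X euclideanreal f \<longrightarrow> bounded (f ` A))"

text \<open>The class instance on \<open>nat \<Rightarrow> nat\<close> is the product of discrete topologies; no separation
  axiom is imposed on \<open>T\<close>, and \<open>\<phi> s\<close> may be empty.\<close>

definition K_countably_determined :: "'a topology \<Rightarrow> bool"
  where "K_countably_determined T \<longleftrightarrow>
    (\<exists>(S :: (nat \<Rightarrow> nat) set) (\<phi> :: (nat \<Rightarrow> nat) \<Rightarrow> 'a set).
       (\<forall>s\<in>S. compactin T (\<phi> s)) \<and>
       (\<forall>U. openin T U \<longrightarrow> openin (top_of_set S) {s \<in> S. \<phi> s \<subseteq> U}) \<and>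
       topspace T = (\<Union>s\<in>S. \<phi> s))"

definition K_countably_determined_subset :: "'a topology \<Rightarrow> 'a set \<Rightarrow> bool"
  where "K_countably_determined_subset X A \<longleftrightarrow>
    A \<subseteq> topspace X \<and> K_countably_determined (subtopology X A)"


text \<open>A strategy of \<open>\<beta>\<close> maps the list \<open>[(V\<^sub>1, P\<^sub>1), \<dots>, (V\<^sub>n, P\<^sub>n)]\<close> of the moves that \<open>\<alpha>\<close> has made
  so far to the answer \<open>U\<^sub>n\<close>; the value at \<open>[]\<close> is the opening move \<open>U\<^sub>0\<close>.\<close>

type_synonym 'a beta_strategy = "('a set \<times> 'a set) list \<Rightarrow> 'a set"

definition alpha_move :: "'a topology \<Rightarrow> 'a set set \<Rightarrow> 'a set \<Rightarrow> 'a set \<times> 'a set \<Rightarrow> bool"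
  where "alpha_move X \<P> U m \<longleftrightarrow>
    openin X (fst m) \<and> fst m \<noteq> {} \<and> fst m \<subseteq> U \<and> snd m \<in> \<P>"

text \<open>Legality of the answers is demanded after every finite sequence of legal moves of \<open>\<alpha>\<close>, not
  only along infinite plays: if \<open>\<P>\<close> is empty there are no infinite plays, and then every legal
  strategy of \<open>\<beta>\<close> is winning, since \<open>\<alpha>\<close> cannot move.\<close>

definition legal_beta_strategy :: "'a topology \<Rightarrow> 'a set set \<Rightarrow> 'a beta_strategy \<Rightarrow> bool"
  where "legal_beta_strategy X \<P> \<sigma> \<longleftrightarrow>
    (\<forall>ms. (\<forall>i<length ms. alpha_move X \<P> (\<sigma> (take i ms)) (ms ! i)) \<longrightarrow>
       openin X (\<sigma> ms) \<and> \<sigma> ms \<noteq> {} \<and> (ms \<noteq> [] \<longrightarrow> \<sigma> ms \<subseteq> fst (last ms)))"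

text \<open>In an infinite play, \<open>V n\<close> and \<open>P n\<close> form the move that is usually numbered \<open>n + 1\<close>.\<close>

definition winning_beta_strategy :: "'a topology \<Rightarrow> 'a set set \<Rightarrow> 'a beta_strategy \<Rightarrow> bool"
  where "winning_beta_strategy X \<P> \<sigma> \<longleftrightarrow> legal_beta_strategy X \<P> \<sigma> \<and>
    (\<forall>V P. (\<forall>n. alpha_move X \<P> (\<sigma> (map (\<lambda>i. (V i, P i)) [0..<n])) (V n, P n)) \<longrightarrow>
       (\<Inter>n. V n) \<inter> (X closure_of (\<Union>n. P n)) = {})"

definition beta_unfavorable :: "'a topology \<Rightarrow> 'a set set \<Rightarrow> bool"
  where "beta_unfavorable X \<P> \<longleftrightarrow> \<not> (\<exists>\<sigma>. winning_beta_strategy X \<P> \<sigma>)"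


text \<open>The index set \<open>S\<close> of the ambient power may be any set. Quantifying over subsets of the type
  \<open>'k \<Rightarrow> real\<close> loses nothing: coordinates that agree on \<open>Z\<close> can be identified, and the remaining
  ones are distinct real functions on \<open>K\<close>. This is \<open>Valdivia_compactI\<close> below, which admits
  index sets of an arbitrary type.\<close>

definition Valdivia_compact :: "'k topology \<Rightarrow> bool"
  where "Valdivia_compact K \<longleftrightarrow> compact_space K \<and>
    (\<exists>(S :: ('k \<Rightarrow> real) set) Z.
       compactin (real_power S) Z \<and>
       K homeomorphic_space subtopology (real_power S) Z \<and>
       subtopology (real_power S) Z closure_of {z \<in> Z. countable {s \<in> S. z s \<noteq> 0}} = Z)"

lemma Valdivia_compactI:
  fixes K :: "'k topology" and S :: "'s set"
  assumes Z: "compactin (real_power S) Z"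
    and hom: "K homeomorphic_space subtopology (real_power S) Z"
    and dense: "subtopology (real_power S) Z closure_of {z \<in> Z. countable {s \<in> S. z s \<noteq> 0}} = Z"
  shows "Valdivia_compact K"
proof -
  let ?Z = "subtopology (real_power S) Z"
  obtain h where h: "homeomorphic_map K ?Z h"
    using hom by (auto simp: homeomorphic_space)
  have ZS: "Z \<subseteq> topspace (real_power S)"
    using Z by (rule compactin_subset_topspace)
  then have tZ: "topspace ?Z = Z" by auto
  have him: "h ` topspace K = Z"
    using homeomorphic_imp_surjective_map[OF h] tZ by simp
  define g where "g s = restrict (\<lambda>k. h k s) (topspace K)" for s
  define S' where "S' = g ` S"
  define r where "r = inv_into S g"
  define e :: "('s \<Rightarrow> real) \<Rightarrow> ('k \<Rightarrow> real) \<Rightarrow> real" where "e z = restrict (\<lambda>t. z (r t)) S'" for z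
  have rS: "r t \<in> S" "g (r t) = t" if "t \<in> S'" for t
    using that by (auto simp: S'_def r_def inv_into_into f_inv_into_f)
  have agree: "z (r (g s)) = z s" if zs: "z \<in> Z" "s \<in> S" for z s
  proof -
    obtain k where k: "k \<in> topspace K" "z = h k" using him zs(1) by blast
    have "g (r (g s)) k = g s k" using rS(2)[of "g s"] that by (simp add: S'_def)
    then show ?thesis using k by (simp add: g_def)
  qed
  have econt: "continuous_map (real_power S) (real_power S') e"
    unfolding continuous_map_componentwise
  proof (intro conjI ballI)
    show "e ` topspace (real_power S) \<subseteq> extensional S'" by (auto simp: e_def)
  next
    fix t assume t: "t \<in> S'"
    then have "(\<lambda>z. e z t) = (\<lambda>z. z (r t))" by (auto simp: e_def)
    then show "continuous_map (real_power S) euclideanreal (\<lambda>z. e z t)"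
      using continuous_map_product_projection[of "r t" S "\<lambda>_. euclideanreal"] rS(1)[OF t] by simp
  qed
  let ?W = "subtopology (real_power S') (e ` Z)"
  have W: "compactin (real_power S') (e ` Z)"
    using Z econt by (rule image_compactin)
  have tW: "topspace ?W = e ` Z"
    using compactin_subset_topspace[OF W] by auto
  have einj: "inj_on e Z"
  proof (rule inj_onI)
    fix y z assume yz: "y \<in> Z" "z \<in> Z" "e y = e z"
    show "y = z"
    proof (rule PiE_ext[of _ S "\<lambda>_. UNIV"])
      show "y \<in> S \<rightarrow>\<^sub>E UNIV" "z \<in> S \<rightarrow>\<^sub>E UNIV" using yz ZS by auto
      fix s assume s: "s \<in> S"
      have "e y (g s) = e z (g s)" using yz by simp
      then have "y (r (g s)) = z (r (g s))" using s by (simp add: e_def S'_def)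
      then show "y s = z s" by (simp only: agree[OF yz(1) s] agree[OF yz(2) s])
    qed
  qed
  have ec: "continuous_map ?Z ?W e"
    unfolding continuous_map_in_subtopology tZ
    using continuous_map_from_subtopology[OF econt] by blast
  have "homeomorphic_map ?Z ?W e"
  proof (rule continuous_imp_homeomorphic_map[OF ec])
    show "compact_space ?Z" using Z by (rule compact_space_subtopology)
    show "Hausdorff_space ?W"
      by (intro Hausdorff_space_subtopology) (simp add: Hausdorff_space_product_topology)
    show "e ` topspace ?Z = topspace ?W" by (simp only: tZ tW)
    show "inj_on e (topspace ?Z)" using einj by (simp only: tZ)
  qed
  then have "K homeomorphic_space ?W"
    by (rule homeomorphic_space_trans[OF hom homeomorphic_map_imp_homeomorphic_space])
  moreover have "?W closure_of {z \<in> e ` Z. countable {s \<in> S'. z s \<noteq> 0}} = e ` Z"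
  proof
    show "?W closure_of {z \<in> e ` Z. countable {s \<in> S'. z s \<noteq> 0}} \<subseteq> e ` Z"
      by (rule closure_of_subset_topspace[of ?W, unfolded tW])
    have "countable {t \<in> S'. e z t \<noteq> 0}" if "countable {s \<in> S. z s \<noteq> 0}" for z
    proof (rule countable_subset)
      show "{t \<in> S'. e z t \<noteq> 0} \<subseteq> g ` {s \<in> S. z s \<noteq> 0}"
      proof
        fix t assume "t \<in> {t \<in> S'. e z t \<noteq> 0}"
        then have t: "t \<in> S'" "z (r t) \<noteq> 0" by (auto simp: e_def)
        then show "t \<in> g ` {s \<in> S. z s \<noteq> 0}"
          using rS[OF t(1)] by (intro image_eqI[of t g "r t"]) auto
      qed
      show "countable (g ` {s \<in> S. z s \<noteq> 0})" using that by blast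
    qed
    then have "e ` {z \<in> Z. countable {s \<in> S. z s \<noteq> 0}}
        \<subseteq> {z \<in> e ` Z. countable {s \<in> S'. z s \<noteq> 0}}" by auto
    then have "?W closure_of e ` {z \<in> Z. countable {s \<in> S. z s \<noteq> 0}}
        \<subseteq> ?W closure_of {z \<in> e ` Z. countable {s \<in> S'. z s \<noteq> 0}}"
      by (rule closure_of_mono)
    with continuous_map_image_closure_subset[OF ec, of "{z \<in> Z. countable {s \<in> S. z s \<noteq> 0}}"]
    show "e ` Z \<subseteq> ?W closure_of {z \<in> e ` Z. countable {s \<in> S'. z s \<noteq> 0}}"
      unfolding dense by (rule subset_trans)
  qed
  moreover have "compact_space K"
    using homeomorphic_compact_space[OF hom] compact_space_subtopology[OF Z] by simp
  ultimately show ?thesis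
    unfolding Valdivia_compact_def using W by (intro conjI exI[of _ S'] exI[of _ "e ` Z"])
qed


definition closed_under_finite_unions :: "'a set set \<Rightarrow> bool"
  where "closed_under_finite_unions \<P> \<longleftrightarrow>
    (\<forall>\<F>. finite \<F> \<and> \<F> \<noteq> {} \<and> \<F> \<subseteq> \<P> \<longrightarrow> \<Union>\<F> \<in> \<P>)"

definition Valdivia_restrictions :: "'a topology \<Rightarrow> 'a set set \<Rightarrow> bool"
  where "Valdivia_restrictions X \<P> \<longleftrightarrow>
    (\<forall>E\<in>\<P>. \<forall>Y. compactin (Cp_space X) Y \<longrightarrow>
       Valdivia_compact (subtopology (Cp_space (subtopology X E)) (restriction_map E ` Y)))"

definition beta_v_unfavorable :: "'a topology \<Rightarrow> bool"
  where "beta_v_unfavorable X \<longleftrightarrow>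
    (\<exists>\<P>. \<P> \<subseteq> Pow (topspace X) \<and> closed_under_finite_unions \<P> \<and>
         Valdivia_restrictions X \<P> \<and> beta_unfavorable X \<P>)"

end

theory Submission
  imports Defs
begin

text \<open>The system \<open>\<P>\<close> itself witnesses the conclusion, so the point is that \<open>K = \<phi>(Y)\<close> is Valdivia for
  every \<open>E \<in> \<P>\<close>; in fact it is a Corson compact. Choose a set \<open>A\<close> of points of \<open>K\<close> that is dense
  modulo a set \<open>B \<subseteq> E\<close>, where \<open>B\<close> in turn is dense, within each of countably many pieces of \<open>E\<close>, for
  pointwise convergence on \<open>A\<close>. Then \<open>B\<close> separates the points of the closure of \<open>A\<close>: for
  \<open>\<K>\<close>-countably-determined \<open>E\<close> by compactness and upper semicontinuity (Gul'ko), for bounded \<open>E\<close> by a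
  double limit argument (Grothendieck). Hence \<open>A\<close> and \<open>B\<close> define a continuous retraction of \<open>K\<close> onto
  the closure of \<open>A\<close>. Such pairs are the closed sets of a finitary closure operator with countable
  closures of countable sets, and a transfinite induction along chains of these retractions produces
  a point-countable separating family of continuous functions, that is, an embedding of \<open>K\<close> into a
  \<open>\<Sigma>\<close>-product of lines.\<close>

section \<open>Countable approximation and finitary closure\<close>

text \<open>Subsets of a finite power of the line are separable, and this is pulled back along
  \<open>z \<mapsto> (f j z)\<close>. The induction cuts \<open>Z\<close> into countably many boxes
  by rational bounds on the new coordinate and applies the hypothesis to each box, so
  \<open>Z\<close> has to be arbitrary.\<close>

lemma countable_simultaneously_dense_subset:
  fixes f :: "'j \<Rightarrow> 'z \<Rightarrow> real"
  assumes "finite J"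
  shows "\<exists>Z0. countable Z0 \<and> Z0 \<subseteq> Z \<and>
    (\<forall>z\<in>Z. \<forall>\<epsilon>>0. \<exists>z0\<in>Z0. \<forall>j\<in>J. \<bar>f j z0 - f j z\<bar> < \<epsilon>)"
  using assms
proof (induction J arbitrary: Z rule: finite_induct)
  case empty
  show ?case
  proof (cases "Z = {}")
    case False
    then obtain z where "z \<in> Z" by blast
    then show ?thesis by (intro exI[of _ "{z}"]) auto
  qed auto
next
  case (insert j J)
  define box where "box p q = {z \<in> Z. of_rat p < f j z \<and> f j z < of_rat q}" for p q
  have "\<forall>p q. \<exists>Z0. countable Z0 \<and> Z0 \<subseteq> box p q \<and>
    (\<forall>z\<in>box p q. \<forall>\<epsilon>>0. \<exists>z0\<in>Z0. \<forall>i\<in>J. \<bar>f i z0 - f i z\<bar> < \<epsilon>)"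
    using insert.IH by blast
  then obtain D where D: "\<And>p q. countable (D p q)" "\<And>p q. D p q \<subseteq> box p q"
    "\<And>p q z \<epsilon>. z \<in> box p q \<Longrightarrow> \<epsilon> > 0 \<Longrightarrow> \<exists>z0\<in>D p q. \<forall>i\<in>J. \<bar>f i z0 - f i z\<bar> < \<epsilon>"
    by metis
  show ?case
  proof (intro exI[of _ "\<Union>p. \<Union>q. D p q"] conjI ballI allI impI)
    show "countable (\<Union>p. \<Union>q. D p q)" using D(1) by blast
    show "(\<Union>p. \<Union>q. D p q) \<subseteq> Z" using D(2) by (fastforce simp: box_def)
  next
    fix z and \<epsilon> :: real assume z: "z \<in> Z" "\<epsilon> > 0"
    obtain p where p: "f j z - \<epsilon>/2 < of_rat p" "of_rat p < f j z"
      using of_rat_dense[of "f j z - \<epsilon>/2" "f j z"] z by auto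
    obtain q where q: "f j z < of_rat q" "of_rat q < f j z + \<epsilon>/2"
      using of_rat_dense[of "f j z" "f j z + \<epsilon>/2"] z by auto
    have "z \<in> box p q" using z p q by (auto simp: box_def)
    from D(3)[OF this z(2)] obtain z0 where z0: "z0 \<in> D p q" "\<forall>i\<in>J. \<bar>f i z0 - f i z\<bar> < \<epsilon>" by blast
    then have "z0 \<in> box p q" using D(2) by blast
    then have "\<bar>f j z0 - f j z\<bar> < \<epsilon>" using p q by (auto simp: box_def)
    with z0 show "\<exists>z0\<in>\<Union>p. \<Union>q. D p q. \<forall>i\<in>insert j J. \<bar>f i z0 - f i z\<bar> < \<epsilon>" by auto
  qed
qed

text \<open>With the dense set a function of \<open>J\<close> and \<open>Z\<close>, a closing-off
  operator can call it on every finite set.\<close>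

lemma countable_simultaneously_dense_choice:
  fixes f :: "'j \<Rightarrow> 'z \<Rightarrow> real"
  obtains c where "\<And>J Z. finite J \<Longrightarrow> countable (c J Z)" "\<And>J Z. finite J \<Longrightarrow> c J Z \<subseteq> Z"
    "\<And>J Z z \<epsilon>. \<lbrakk>finite J; z \<in> Z; \<epsilon> > 0\<rbrakk> \<Longrightarrow> \<exists>z0\<in>c J Z. \<forall>j\<in>J. \<bar>f j z0 - f j z\<bar> < \<epsilon>"
proof -
  define c where "c J Z = (SOME Z0. countable Z0 \<and> Z0 \<subseteq> Z \<and>
    (\<forall>z\<in>Z. \<forall>\<epsilon>>0. \<exists>z0\<in>Z0. \<forall>j\<in>J. \<bar>f j z0 - f j z\<bar> < \<epsilon>))" for J Z
  have "countable (c J Z) \<and> c J Z \<subseteq> Z \<and>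
    (\<forall>z\<in>Z. \<forall>\<epsilon>>0. \<exists>z0\<in>c J Z. \<forall>j\<in>J. \<bar>f j z0 - f j z\<bar> < \<epsilon>)" if "finite J" for J Z
    unfolding c_def by (rule someI_ex[OF countable_simultaneously_dense_subset[OF that]])
  then show thesis by (intro that[of c]) simp_all
qed

text \<open>\<open>\<Phi>\<close> acts on finite subsets only, which makes the closure finitary.
  Taken as an intersection, the closure is monotone and closed at once; stages appear only in the
  countability proof.\<close>

definition generated :: "('u set \<Rightarrow> 'u set) \<Rightarrow> 'u set \<Rightarrow> 'u set"
  where "generated \<Phi> G = \<Inter>{M. G \<subseteq> M \<and> (\<forall>F. finite F \<and> F \<subseteq> M \<longrightarrow> \<Phi> F \<subseteq> M)}"

lemma generated_superset: "G \<subseteq> generated \<Phi> G"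
  by (auto simp: generated_def)

lemma generated_mono: "G \<subseteq> H \<Longrightarrow> generated \<Phi> G \<subseteq> generated \<Phi> H"
  unfolding generated_def by blast

lemma generated_closed: "finite F \<Longrightarrow> F \<subseteq> generated \<Phi> G \<Longrightarrow> \<Phi> F \<subseteq> generated \<Phi> G"
  unfolding generated_def by blast

lemma generated_least:
  assumes "G \<subseteq> U" "\<And>F. finite F \<Longrightarrow> F \<subseteq> U \<Longrightarrow> \<Phi> F \<subseteq> U"
  shows "generated \<Phi> G \<subseteq> U"
  using assms unfolding generated_def by blast

text \<open>The closures of finite subsets of \<open>G\<close> are directed upwards. A finite subset
  of their union therefore lies in a single one of them, so the union is itself closed under
  \<open>\<Phi>\<close>.\<close>

lemma generated_finitary:
  assumes x: "x \<in> generated \<Phi> G"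
  shows "\<exists>F. finite F \<and> F \<subseteq> G \<and> x \<in> generated \<Phi> F"
proof -
  let ?U = "\<Union>F\<in>{F. finite F \<and> F \<subseteq> G}. generated \<Phi> F"
  have "generated \<Phi> G \<subseteq> ?U"
  proof (rule generated_least)
    show "G \<subseteq> ?U"
    proof
      fix x assume "x \<in> G"
      then show "x \<in> ?U" using generated_superset[of "{x}"] by (intro UN_I[of "{x}"]) auto
    qed
  next
    fix F assume F: "finite F" "F \<subseteq> ?U"
    then have "\<forall>x\<in>F. \<exists>H. finite H \<and> H \<subseteq> G \<and> x \<in> generated \<Phi> H" by blast
    then obtain H where H: "\<And>x. x \<in> F \<Longrightarrow> finite (H x) \<and> H x \<subseteq> G \<and> x \<in> generated \<Phi> (H x)" by metis
    have "F \<subseteq> generated \<Phi> (\<Union>x\<in>F. H x)" using H generated_mono[OF UN_upper[of _ F H]] by blast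
    then have "\<Phi> F \<subseteq> generated \<Phi> (\<Union>x\<in>F. H x)" by (rule generated_closed[OF F(1)])
    moreover have "finite (\<Union>x\<in>F. H x)" "(\<Union>x\<in>F. H x) \<subseteq> G" using F H by auto
    ultimately show "\<Phi> F \<subseteq> ?U" by blast
  qed
  then show ?thesis using x by blast
qed

text \<open>Countably many stages suffice: a finite subset of their union already lies in one stage,
  and a countable stage has only countably many finite subsets.\<close>

lemma countable_generated:
  assumes \<Phi>: "\<And>F. finite F \<Longrightarrow> countable (\<Phi> F)" and G: "countable G"
  shows "countable (generated \<Phi> G)"
proof -
  define step where "step M = M \<union> (\<Union>F\<in>{F. finite F \<and> F \<subseteq> M}. \<Phi> F)" for M
  define M where "M n = (step ^^ n) G" for n
  have M: "countable (M n)" for n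
  proof (induction n)
    case (Suc n)
    then have "countable {F. finite F \<and> F \<subseteq> M n}" by (rule countable_Collect_finite_subset)
    with Suc show ?case by (auto simp: M_def step_def simp: \<Phi>)
  qed (simp add: M_def G)
  have inc: "M n \<subseteq> M (Suc n)" for n by (auto simp: M_def step_def)
  then have incs: "M m \<subseteq> M n" if "m \<le> n" for m n using that by (rule lift_Suc_mono_le)
  have "generated \<Phi> G \<subseteq> (\<Union>n. M n)"
  proof (rule generated_least)
    show "G \<subseteq> (\<Union>n. M n)" by (rule order_trans[OF _ UN_upper[of 0]]) (simp_all add: M_def)
  next
    fix F assume F: "finite F" "F \<subseteq> (\<Union>n. M n)"
    from F(2) have "\<forall>x\<in>F. \<exists>n. x \<in> M n" by blast
    then obtain k where k: "\<And>x. x \<in> F \<Longrightarrow> x \<in> M (k x)" by metis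
    \<comment> \<open>\<open>Max\<close> is unspecified for empty \<open>F\<close>, but then every
      stage contains \<open>F\<close>.\<close>
    define n where "n = Max (k ` F)"
    have "F \<subseteq> M n"
    proof
      fix x assume x: "x \<in> F"
      then have "k x \<le> n" using F(1) by (simp add: n_def)
      then show "x \<in> M n" using k[OF x] incs by blast
    qed
    then have "\<Phi> F \<subseteq> M (Suc n)" using F by (auto simp: M_def step_def)
    then show "\<Phi> F \<subseteq> (\<Union>n. M n)" by blast
  qed
  moreover have "countable (\<Union>n. M n)" using M by blast
  ultimately show ?thesis by (rule countable_subset)
qed

section \<open>Closure points, and exact values from approximate ones by compactness\<close>

lemma closure_of_approximation:
  assumes x: "x \<in> K closure_of A" and F: "finite F"
    and cont: "\<And>t. t \<in> F \<Longrightarrow> continuous_map K euclideanreal (f t)" and e: "(\<epsilon>::real) > 0"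
  shows "\<exists>a\<in>A. \<forall>t\<in>F. \<bar>f t a - f t x\<bar> < \<epsilon>"
proof -
  have op: "openin K {a \<in> topspace K. \<forall>t\<in>F. \<bar>f t a - f t x\<bar> < \<epsilon>}" (is "openin K ?U")
    using F cont
  proof (induction F rule: finite_induct)
    case (insert t F)
    have "open {y. \<bar>y - f t x\<bar> < \<epsilon>}" by (intro open_Collect_less continuous_intros)
    then have "openin K {a \<in> topspace K. f t a \<in> {y. \<bar>y - f t x\<bar> < \<epsilon>}}"
      by (intro openin_continuous_map_preimage[OF insert.prems[OF insertI1]]) (rule open_openin[THEN iffD1])
    moreover have "openin K {a \<in> topspace K. \<forall>t\<in>F. \<bar>f t a - f t x\<bar> < \<epsilon>}"
      using insert.IH insert.prems by blast
    moreover have "{a \<in> topspace K. \<forall>t\<in>insert t F. \<bar>f t a - f t x\<bar> < \<epsilon>}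
      = {a \<in> topspace K. f t a \<in> {y. \<bar>y - f t x\<bar> < \<epsilon>}} \<inter> {a \<in> topspace K. \<forall>t\<in>F. \<bar>f t a - f t x\<bar> < \<epsilon>}"
      by auto
    ultimately show ?case by (simp only: openin_Int)
  qed simp
  have "x \<in> ?U" using x e by (simp add: in_closure_of)
  then obtain a where "a \<in> A" "a \<in> ?U" using x op unfolding in_closure_of by meson
  then show ?thesis by blast
qed

text \<open>The closed conditions \<open>D\<close> have the finite intersection property, so
  approximate solutions for finitely many \<open>t\<close> yield one exact solution. The values
  \<open>v\<close> may come from outside \<open>K\<close>; later they are those of a function on
  \<open>E\<close>, to be realized by a member of \<open>Y\<close>.\<close>

lemma compact_value_lifting:
  fixes f :: "'t \<Rightarrow> 'k \<Rightarrow> real"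
  assumes K: "compact_space K" and cont: "\<And>t. t \<in> B \<Longrightarrow> continuous_map K euclideanreal (f t)"
    and C: "A \<subseteq> C" "closedin K C"
    and approx: "\<And>F \<epsilon>. finite F \<Longrightarrow> F \<subseteq> B \<Longrightarrow> \<epsilon> > 0 \<Longrightarrow> \<exists>a\<in>A. \<forall>t\<in>F. \<bar>f t a - v t\<bar> < \<epsilon>"
  shows "\<exists>a\<in>C. \<forall>t\<in>B. f t a = v t"
proof -
  define D where "D p = C \<inter> {a \<in> topspace K. f (fst p) a \<in> {y. \<bar>y - v (fst p)\<bar> \<le> snd p}}" for p :: "'t \<times> real"
  have D: "closedin K (D p)" if "p \<in> B \<times> {0<..}" for p
  proof -
    have "closed {y. \<bar>y - v (fst p)\<bar> \<le> snd p}" by (intro closed_Collect_le continuous_intros)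
    then show ?thesis unfolding D_def using that cont
      by (intro closedin_Int C closedin_continuous_map_preimage[of _ euclideanreal]) (auto simp del: mem_Collect_eq)
  qed
  have "\<Inter>(insert C (D ` (B \<times> {0<..}))) \<noteq> {}"
  proof (rule compact_space_fip[THEN iffD1, OF K, rule_format], intro conjI ballI allI impI; (elim conjE)?)
    fix E assume "E \<in> insert C (D ` (B \<times> {0<..}))"
    then show "closedin K E" using C(2) D by blast
  next
    fix \<F> assume F: "finite \<F>" "\<F> \<subseteq> insert C (D ` (B \<times> {0<..}))"
    have "finite (\<F> - {C})" "\<F> - {C} \<subseteq> D ` (B \<times> {0<..})" using F by auto
    then obtain Q where Q: "Q \<subseteq> B \<times> {0<..}" "finite Q" "\<F> - {C} = D ` Q"
      using finite_subset_image by metis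
    \<comment> \<open>The extra 1 keeps the minimum defined and positive when \<open>Q\<close> is
      empty.\<close>
    define \<epsilon> where "\<epsilon> = Min (insert 1 (snd ` Q))"
    have \<epsilon>: "\<epsilon> > 0" "\<And>p. p \<in> Q \<Longrightarrow> \<epsilon> \<le> snd p" using Q by (auto simp: \<epsilon>_def)
    obtain a where a: "a \<in> A" "\<forall>t\<in>fst`Q. \<bar>f t a - v t\<bar> < \<epsilon>"
      using approx[of "fst ` Q" \<epsilon>] Q \<epsilon> by force
    have aC: "a \<in> C" "a \<in> topspace K" using a C closedin_subset by blast+
    have "a \<in> D p" if "p \<in> Q" for p
      using a(2) \<epsilon>(2)[OF that] that aC by (force simp: D_def)
    then show "\<Inter>\<F> \<noteq> {}" using aC Q(3) by blast
  qed
  then obtain a where a: "a \<in> C" "\<And>p. p \<in> B \<times> {0<..} \<Longrightarrow> a \<in> D p" by auto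
  have "f t a = v t" if "t \<in> B" for t
  proof (rule ccontr)
    assume "f t a \<noteq> v t"
    then show False using a(2)[of "(t, \<bar>f t a - v t\<bar>/2)"] that by (auto simp: D_def)
  qed
  then show ?thesis using a by blast
qed

section \<open>Retractions\<close>

definition agree_on :: "('t \<Rightarrow> 'k \<Rightarrow> real) \<Rightarrow> 't set \<Rightarrow> 'k \<Rightarrow> 'k \<Rightarrow> bool"
  where "agree_on ev B x y \<longleftrightarrow> (\<forall>t\<in>B. ev t x = ev t y)"

text \<open>Density for the weak topology induced by \<open>B\<close>. With \<open>X = {x}\<close>
  it expresses that \<open>x\<close> is in the weak closure of \<open>A\<close>.\<close>

definition points_dense :: "'k set \<Rightarrow> ('t \<Rightarrow> 'k \<Rightarrow> real) \<Rightarrow> 'k set \<Rightarrow> 't set \<Rightarrow> bool"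
  where "points_dense X ev A B \<longleftrightarrow>
    (\<forall>x\<in>X. \<forall>F \<epsilon>. finite F \<and> F \<subseteq> B \<and> \<epsilon> > 0 \<longrightarrow> (\<exists>a\<in>A. \<forall>t\<in>F. \<bar>ev t a - ev t x\<bar> < \<epsilon>))"

text \<open>The dual density, relative to each piece separately: knowing in which piece an
  approximant lies is what the argument for \<open>\<K>\<close>-countably-determined sets rests
  on.\<close>

definition functions_dense :: "'t set set \<Rightarrow> ('t \<Rightarrow> 'k \<Rightarrow> real) \<Rightarrow> 'k set \<Rightarrow> 't set \<Rightarrow> bool"
  where "functions_dense \<C> ev A B \<longleftrightarrow>
    (\<forall>C\<in>\<C>. \<forall>t\<in>C. \<forall>F \<epsilon>. finite F \<and> F \<subseteq> A \<and> \<epsilon> > 0 \<longrightarrow>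
      (\<exists>b\<in>B \<inter> C. \<forall>a\<in>F. \<bar>ev b a - ev t a\<bar> < \<epsilon>))"

text \<open>The condition \<open>sep\<close> is all that is used of the topology of the space \<open>T\<close>: functions of \<open>B\<close>
  that approximate \<open>T\<close> pointwise on \<open>A\<close>, within every piece, separate the points of the closure
  of \<open>A\<close>. For the choice \<open>A = topspace K\<close>, \<open>B = T\<close> it says that \<open>T\<close> separates points, so that \<open>K\<close>
  is Hausdorff.\<close>

locale function_system =
  fixes K :: "'k topology" and T :: "'t set" and ev :: "'t \<Rightarrow> 'k \<Rightarrow> real" and \<C> :: "'t set set"
  assumes compact: "compact_space K"
    and cont: "t \<in> T \<Longrightarrow> continuous_map K euclideanreal (ev t)"
    and countable_pieces: "countable \<C>"
    and pieces: "C \<in> \<C> \<Longrightarrow> C \<subseteq> T"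
    and sep: "\<lbrakk>A \<subseteq> topspace K; B \<subseteq> T; functions_dense \<C> ev A B; x \<in> K closure_of A;
      y \<in> K closure_of A; agree_on ev B x y\<rbrakk> \<Longrightarrow> x = y"
begin

text \<open>Compactness provides such a point if \<open>A\<close> is dense for \<open>B\<close>; if
  \<open>B\<close> is also dense for \<open>A\<close>, then \<open>sep\<close> makes it unique. In
  that case the choice is forced and the points of the closure of \<open>A\<close> are
  fixed.\<close>

definition "retr A B x = (SOME a. a \<in> K closure_of A \<and> agree_on ev B a x)"

lemma closed_set_lifting:
  assumes "B \<subseteq> T" "A \<subseteq> C" "closedin K C" "points_dense {x} ev A B"
  shows "\<exists>a\<in>C. agree_on ev B a x"
  unfolding agree_on_def
proof (rule compact_value_lifting[OF compact _ assms(2,3)])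
  show "continuous_map K euclideanreal (ev t)" if "t \<in> B" for t using that assms(1) cont by auto
  show "\<exists>a\<in>A. \<forall>t\<in>F. \<bar>ev t a - ev t x\<bar> < \<epsilon>" if "finite F" "F \<subseteq> B" "\<epsilon> > 0" for F \<epsilon>
    using assms(4) that by (simp add: points_dense_def)
qed

lemma retr:
  assumes "A \<subseteq> topspace K" "B \<subseteq> T" "points_dense (topspace K) ev A B" "x \<in> topspace K"
  shows "retr A B x \<in> K closure_of A" "agree_on ev B (retr A B x) x"
proof -
  have "\<exists>a\<in>K closure_of A. agree_on ev B a x"
  proof (rule closed_set_lifting[OF assms(2)])
    show "A \<subseteq> K closure_of A" using assms(1) by (rule closure_of_subset)
    show "points_dense {x} ev A B" using assms(3,4) by (simp add: points_dense_def)
  qed simp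
  then have "retr A B x \<in> K closure_of A \<and> agree_on ev B (retr A B x) x"
    unfolding retr_def Bex_def by (rule someI_ex)
  then show "retr A B x \<in> K closure_of A" "agree_on ev B (retr A B x) x" by auto
qed

lemma retr_eqI:
  assumes "A \<subseteq> topspace K" "B \<subseteq> T" "points_dense (topspace K) ev A B" "functions_dense \<C> ev A B"
    and "x \<in> topspace K" "a \<in> K closure_of A" "agree_on ev B a x"
  shows "retr A B x = a"
proof (rule sep[OF assms(1,2,4)])
  show "agree_on ev B (retr A B x) a"
    using retr(2)[OF assms(1-3,5)] assms(7) by (simp add: agree_on_def)
  show "retr A B x \<in> K closure_of A" using retr(1)[OF assms(1-3,5)] .
qed (rule assms(6))

text \<open>Let \<open>x\<close> be a limit of points whose images lie in the closed set
  \<open>C\<close>. These images approximate \<open>x\<close> on finite subsets of \<open>B\<close>,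
  so compactness gives a point of \<open>C\<close> in the closure of \<open>A\<close> that agrees
  with \<open>x\<close> on \<open>B\<close>. By uniqueness it is the image of
  \<open>x\<close>.\<close>

lemma continuous_map_retr:
  assumes AB: "A \<subseteq> topspace K" "B \<subseteq> T" "points_dense (topspace K) ev A B" "functions_dense \<C> ev A B"
  shows "continuous_map K K (retr A B)"
  unfolding continuous_map_closedin
proof (intro conjI allI impI)
  show "retr A B \<in> topspace K \<rightarrow> topspace K"
    using retr(1)[OF AB(1-3)] by (auto simp: in_closure_of)
  fix C assume C: "closedin K C"
  let ?P = "{x \<in> topspace K. retr A B x \<in> C}"
  have "K closure_of ?P \<subseteq> ?P"
  proof
    fix x assume x: "x \<in> K closure_of ?P"
    then have xK: "x \<in> topspace K" by (simp add: in_closure_of)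
    have cl: "closedin K (C \<inter> K closure_of A)" using C by auto
    have "points_dense {x} ev (C \<inter> K closure_of A) B"
      unfolding points_dense_def
    proof (intro ballI allI impI, elim conjE singletonE)
      fix z F and \<epsilon> :: real assume F: "finite F" "F \<subseteq> B" "\<epsilon> > 0" and z: "z = x"
      obtain y where y: "y \<in> ?P" "\<forall>t\<in>F. \<bar>ev t y - ev t x\<bar> < \<epsilon>"
        using closure_of_approximation[OF x F(1) _ F(3)] cont F(2) AB(2) by blast
      have "retr A B y \<in> C \<inter> K closure_of A" "agree_on ev B (retr A B y) y"
        using retr[OF AB(1-3)] y by auto
      then show "\<exists>a\<in>C \<inter> K closure_of A. \<forall>t\<in>F. \<bar>ev t a - ev t z\<bar> < \<epsilon>"
        using y(2) F(2) z by (intro bexI[of _ "retr A B y"]) (auto simp: agree_on_def subset_iff)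
    qed
    from closed_set_lifting[OF AB(2) order_refl cl this]
    obtain a where "a \<in> C" "a \<in> K closure_of A" "agree_on ev B a x" by auto
    with retr_eqI[OF AB xK] show "x \<in> ?P" using xK by auto
  qed
  then show "closedin K ?P" by (subst closure_of_subset_eq[symmetric]) auto
qed

text \<open>A pair of a set of points and a set of functions that are dense for each other plays the role
  of (the trace of) an elementary submodel.\<close>

lemma submodel_closure:
  assumes A: "A \<subseteq> topspace K" and D: "finite D"
  obtains cl :: "('k + 't) set \<Rightarrow> ('k + 't) set" where
    "\<And>G. G \<subseteq> cl G" "\<And>G H. G \<subseteq> H \<Longrightarrow> cl G \<subseteq> cl H"
    "\<And>G. countable G \<Longrightarrow> countable (cl G)"
    "\<And>G x. x \<in> cl G \<Longrightarrow> \<exists>F. finite F \<and> F \<subseteq> G \<and> x \<in> cl F"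
    "\<And>G. G \<subseteq> A <+> T \<Longrightarrow> cl G \<subseteq> A <+> T"
    "\<And>G. G \<subseteq> A <+> T \<Longrightarrow> points_dense A ev (Inl -` cl G) (Inr -` cl G)"
    "\<And>G. G \<subseteq> A <+> T \<Longrightarrow> functions_dense \<C> ev (D \<union> Inl -` cl G) (Inr -` cl G)"
proof -
  obtain c where c: "\<And>F C. finite F \<Longrightarrow> countable (c F C)" "\<And>F C. finite F \<Longrightarrow> c F C \<subseteq> C"
    "\<And>F C z \<epsilon>. \<lbrakk>finite F; z \<in> C; \<epsilon> > 0\<rbrakk> \<Longrightarrow> \<exists>a\<in>c F C. \<forall>t\<in>F. \<bar>ev t a - ev t z\<bar> < \<epsilon>"
    using countable_simultaneously_dense_choice[of ev] by metis
  obtain d where d: "\<And>F C. finite F \<Longrightarrow> countable (d F C)" "\<And>F C. finite F \<Longrightarrow> d F C \<subseteq> C"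
    "\<And>F C t \<epsilon>. \<lbrakk>finite F; t \<in> C; \<epsilon> > 0\<rbrakk> \<Longrightarrow> \<exists>b\<in>d F C. \<forall>a\<in>F. \<bar>ev b a - ev t a\<bar> < \<epsilon>"
    using countable_simultaneously_dense_choice[of "\<lambda>a t. ev t a"] by metis
  \<comment> \<open>\<open>Inl\<close> codes points and \<open>Inr\<close> functions. The finite set
    \<open>D\<close> holds additional points, possibly outside \<open>A\<close>, at which the chosen
    functions must approximate as well.\<close>
  define \<Phi> where "\<Phi> P = Inl ` c (Inr -` P) A \<union> Inr ` (\<Union>C\<in>\<C>. d (D \<union> Inl -` P) C)" for P
  have fin: "finite (Inl -` P)" "finite (Inr -` P)" if "finite P" for P :: "('k + 't) set"
    using that by (auto intro!: finite_vimageI)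
  have countable_\<Phi>: "countable (\<Phi> P)" if "finite P" for P
    unfolding \<Phi>_def using fin[OF that] D
    by (intro countable_Un countable_image countable_UN countable_pieces c(1) d(1) finite_UnI)
  show thesis
  proof (rule that[of "generated \<Phi>"])
    fix G :: "('k + 't) set"
    show "G \<subseteq> generated \<Phi> G" by (rule generated_superset)
    show "generated \<Phi> G \<subseteq> generated \<Phi> H" if "G \<subseteq> H" for H using that by (rule generated_mono)
    show "countable (generated \<Phi> G)" if "countable G" using countable_\<Phi> that by (rule countable_generated)
    show "\<exists>F. finite F \<and> F \<subseteq> G \<and> x \<in> generated \<Phi> F" if "x \<in> generated \<Phi> G" for x
      using that by (rule generated_finitary)
  next
    fix G :: "('k + 't) set" assume G: "G \<subseteq> A <+> T"
    show "generated \<Phi> G \<subseteq> A <+> T"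
    proof (rule generated_least[OF G])
      fix P assume P: "finite P" "P \<subseteq> A <+> T"
      have "c (Inr -` P) A \<subseteq> A" using c(2) fin[OF P(1)] by auto
      moreover have "d (D \<union> Inl -` P) C \<subseteq> T" if "C \<in> \<C>" for C
        using d(2)[of "D \<union> Inl -` P" C] D fin[OF P(1)] pieces[OF that] by auto
      ultimately show "\<Phi> P \<subseteq> A <+> T" unfolding \<Phi>_def by blast
    qed
    show "points_dense A ev (Inl -` generated \<Phi> G) (Inr -` generated \<Phi> G)"
      unfolding points_dense_def
    proof (intro ballI allI impI, elim conjE)
      fix z F and \<epsilon> :: real assume F: "finite F" "F \<subseteq> Inr -` generated \<Phi> G" "\<epsilon> > 0" and z: "z \<in> A"
      let ?Q = "Inr ` F :: ('k + 't) set"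
      obtain a where a: "a \<in> c F A" "\<forall>t\<in>F. \<bar>ev t a - ev t z\<bar> < \<epsilon>"
        using c(3)[OF F(1) z F(3)] by blast
      have "Inr -` ?Q = F" by auto
      then have "Inl a \<in> \<Phi> ?Q" using a(1) by (auto simp: \<Phi>_def)
      then have "a \<in> Inl -` generated \<Phi> G" using generated_closed[of ?Q _ G] F by auto
      with a show "\<exists>a\<in>Inl -` generated \<Phi> G. \<forall>t\<in>F. \<bar>ev t a - ev t z\<bar> < \<epsilon>" by blast
    qed
    show "functions_dense \<C> ev (D \<union> Inl -` generated \<Phi> G) (Inr -` generated \<Phi> G)"
      unfolding functions_dense_def
    proof (intro ballI allI impI, elim conjE)
      fix C t F and \<epsilon> :: real
      assume C: "C \<in> \<C>" "t \<in> C" and F: "finite F" "F \<subseteq> D \<union> Inl -` generated \<Phi> G" "\<epsilon> > 0"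
      \<comment> \<open>The members of \<open>F\<close> outside the closure belong to
        \<open>D\<close>, which \<open>\<Phi>\<close> adds by itself.\<close>
      let ?P = "Inl ` (F \<inter> Inl -` generated \<Phi> G) :: ('k + 't) set"
      have "finite (D \<union> Inl -` ?P)" using F D by (intro finite_UnI finite_vimageI) auto
      then obtain b where b: "b \<in> d (D \<union> Inl -` ?P) C" "b \<in> C"
        "\<forall>a\<in>D \<union> Inl -` ?P. \<bar>ev b a - ev t a\<bar> < \<epsilon>"
        using d(3)[of "D \<union> Inl -` ?P" t C \<epsilon>] d(2)[of "D \<union> Inl -` ?P" C] C F(3) by blast
      have "Inr b \<in> \<Phi> ?P" using b C by (auto simp: \<Phi>_def)
      then have "b \<in> Inr -` generated \<Phi> G" using generated_closed[of ?P _ G] F by auto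
      moreover have "F \<subseteq> D \<union> Inl -` ?P" using F by auto
      ultimately show "\<exists>b\<in>Inr -` generated \<Phi> G \<inter> C. \<forall>a\<in>F. \<bar>ev b a - ev t a\<bar> < \<epsilon>" using b by blast
    qed
  qed
qed

text \<open>A countable submodel with \<open>D = {x}\<close> gives a point \<open>a\<close> in the
  closure of \<open>A0\<close> that agrees with \<open>x\<close> on \<open>B0\<close>. Since
  \<open>B0\<close> is dense for \<open>insert x A0\<close>, \<open>sep\<close> applies to that
  larger set, whose closure contains both points, and gives \<open>a = x\<close>.\<close>

lemma countable_tightness:
  assumes A: "A \<subseteq> topspace K" and x: "x \<in> K closure_of A"
  shows "\<exists>A0. countable A0 \<and> A0 \<subseteq> A \<and> x \<in> K closure_of A0"
proof -
  have xK: "x \<in> topspace K" using x by (simp add: in_closure_of)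
  obtain cl :: "('k + 't) set \<Rightarrow> ('k + 't) set" where cl:
    "\<And>G. countable G \<Longrightarrow> countable (cl G)" "\<And>G. G \<subseteq> A <+> T \<Longrightarrow> cl G \<subseteq> A <+> T"
    "\<And>G. G \<subseteq> A <+> T \<Longrightarrow> points_dense A ev (Inl -` cl G) (Inr -` cl G)"
    "\<And>G. G \<subseteq> A <+> T \<Longrightarrow> functions_dense \<C> ev ({x} \<union> Inl -` cl G) (Inr -` cl G)"
    using submodel_closure[OF A, of "{x}"] by (metis finite.emptyI finite.insertI)
  define M where "M = cl {}"
  have M: "countable M" "M \<subseteq> A <+> T" "points_dense A ev (Inl -` M) (Inr -` M)"
    "functions_dense \<C> ev ({x} \<union> Inl -` M) (Inr -` M)"
    using cl[of "{}"] by (simp_all add: M_def)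
  define A0 where "A0 = Inl -` M"
  define B0 where "B0 = Inr -` M"
  have A0: "A0 \<subseteq> A" and B0: "B0 \<subseteq> T" using M(2) by (auto simp: A0_def B0_def)
  have cntA0: "countable A0"
  proof -
    have "countable (Inl ` A0 :: ('k + 't) set)" by (rule countable_subset[OF _ M(1)]) (auto simp: A0_def)
    then show ?thesis by (simp add: countable_image_inj_eq)
  qed
  have "points_dense {x} ev A0 B0"
    unfolding points_dense_def
  proof (intro ballI allI impI, elim conjE singletonE)
    fix z F and \<epsilon> :: real assume F: "finite F" "F \<subseteq> B0" "\<epsilon> > 0" and z: "z = x"
    obtain a where a: "a \<in> A" "\<forall>t\<in>F. \<bar>ev t a - ev t x\<bar> < \<epsilon>/2"
      using closure_of_approximation[OF x F(1), of ev "\<epsilon>/2"] cont F B0 by auto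
    obtain a' where a': "a' \<in> A0" "\<forall>t\<in>F. \<bar>ev t a' - ev t a\<bar> < \<epsilon>/2"
      using M(3) F a(1) unfolding points_dense_def A0_def B0_def by (meson half_gt_zero)
    have "\<bar>ev t a' - ev t z\<bar> < \<epsilon>" if "t \<in> F" for t
      using a(2)[rule_format, OF that] a'(2)[rule_format, OF that] unfolding z by linarith
    with a'(1) show "\<exists>a\<in>A0. \<forall>t\<in>F. \<bar>ev t a - ev t z\<bar> < \<epsilon>" by blast
  qed
  then obtain a where a: "a \<in> K closure_of A0" "agree_on ev B0 a x"
    using closed_set_lifting[OF B0 closure_of_subset closedin_closure_of] A0 A by (metis order_trans)
  have "functions_dense \<C> ev (insert x A0) B0" using M(4) by (simp add: A0_def B0_def)
  moreover have "insert x A0 \<subseteq> topspace K" using xK A A0 by auto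
  moreover have "a \<in> K closure_of (insert x A0)" using a(1) closure_of_mono[of A0 "insert x A0" K] by auto
  moreover have "x \<in> K closure_of (insert x A0)"
    using closure_of_subset[of "insert x A0" K] calculation(2) by auto
  ultimately have "a = x" using sep[OF _ B0 _ _ _ a(2)] by blast
  with a(1) show ?thesis using cntA0 A0 by auto
qed

end

section \<open>Corson embedding\<close>

text \<open>The induction on cardinality is applied to segments that include their endpoint; in an
  infinite cardinal one extra element keeps them small.\<close>

lemma well_order_small_segments:
  assumes "infinite G"
  obtains r where "well_order_on G r" "\<And>\<alpha>. \<alpha> \<in> G \<Longrightarrow> (card_of (under r \<alpha>), card_of G) \<in> ordLess"
proof
  let ?r = "card_of G"
  show r: "well_order_on G ?r" by (rule card_of_well_order_on)
  fix \<alpha> assume \<alpha>: "\<alpha> \<in> G"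
  have lt: "(card_of (underS ?r \<alpha>), ?r) \<in> ordLess"
    using card_of_underS[OF card_of_Card_order, of \<alpha> G] \<alpha> by (simp add: Field_card_of)
  have "(card_of {\<alpha>}, ?r) \<in> ordLess"
    using assms by (intro finite_ordLess_infinite) (simp_all add: card_of_well_order_on Field_card_of)
  with lt have "(card_of (underS ?r \<alpha> \<union> {\<alpha>}), ?r) \<in> ordLess"
    using assms by (intro card_of_Un_ordLess_infinite)
  moreover have "(card_of (under ?r \<alpha>), card_of (underS ?r \<alpha> \<union> {\<alpha>})) \<in> ordLeq"
    by (rule card_of_mono1) (auto simp: under_def underS_def)
  ultimately show "(card_of (under ?r \<alpha>), ?r) \<in> ordLess"
    by (rule ordLeq_ordLess_trans[rotated])
qed

lemma well_order_on_finite_bound: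
  assumes r: "well_order_on G r" and "finite F" "F \<noteq> {}" "F \<subseteq> G"
  shows "\<exists>\<alpha>\<in>F. F \<subseteq> under r \<alpha>"
  using assms(2-)
proof (induction F rule: finite_ne_induct)
  case (singleton x)
  then show ?case
    using r by (auto simp: under_def order_on_defs refl_on_def)
next
  case (insert x F)
  then obtain \<alpha> where \<alpha>: "\<alpha> \<in> F" "F \<subseteq> under r \<alpha>" by auto
  have xG: "x \<in> G" "\<alpha> \<in> G" using insert.prems \<alpha> by auto
  have refl: "(x, x) \<in> r" using r xG by (auto simp: order_on_defs refl_on_def)
  have trans: "trans r" using r by (auto simp: order_on_defs)
  have "(x, \<alpha>) \<in> r \<or> (\<alpha>, x) \<in> r" using r xG refl by (auto simp: order_on_defs total_on_def)
  then show ?case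
  proof
    assume "(x, \<alpha>) \<in> r"
    then show ?thesis using \<alpha> by (intro bexI[of _ \<alpha>]) (auto simp: under_def)
  next
    assume "(\<alpha>, x) \<in> r"
    then have "F \<subseteq> under r x" using \<alpha>(2) trans by (auto simp: under_def dest: transD)
    then show ?thesis using refl by (intro bexI[of _ x]) (auto simp: under_def)
  qed
qed

lemma well_order_on_least:
  assumes r: "well_order_on G r" and "\<alpha> \<in> Q"
  shows "\<exists>\<alpha>\<in>Q. \<forall>\<beta>\<in>underS r \<alpha>. \<beta> \<notin> Q"
proof -
  have "wf (r - Id)" using r by (simp add: well_order_on_def)
  with assms(2) obtain z where "z \<in> Q" "\<And>y. (y, z) \<in> r - Id \<Longrightarrow> y \<notin> Q"
    by (metis wfE_min)
  then show ?thesis by (intro bexI[of _ z]) (auto simp: underS_def)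
qed

lemma well_order_on_segments:
  assumes r: "well_order_on G r"
  shows "under r \<alpha> \<subseteq> G" "underS r \<alpha> \<subseteq> under r \<alpha>" "under r \<alpha> \<subseteq> insert \<alpha> (underS r \<alpha>)"
    and "\<beta> \<in> underS r \<alpha> \<Longrightarrow> under r \<beta> \<subseteq> underS r \<alpha>"
    and "\<alpha> \<in> G \<Longrightarrow> \<beta> \<in> G \<Longrightarrow> \<alpha> \<notin> under r \<beta> \<Longrightarrow> \<beta> \<in> underS r \<alpha>"
proof -
  have o: "r \<subseteq> G \<times> G" "refl_on G r" "trans r" "antisym r" "total_on G r"
    using r by (auto simp: order_on_defs)
  show "under r \<alpha> \<subseteq> G" using o(1) by (auto simp: under_def)
  show "underS r \<alpha> \<subseteq> under r \<alpha>" by (auto simp: under_def underS_def)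
  show "under r \<alpha> \<subseteq> insert \<alpha> (underS r \<alpha>)" by (auto simp: under_def underS_def)
  show "\<beta> \<in> underS r \<alpha> \<Longrightarrow> under r \<beta> \<subseteq> underS r \<alpha>"
    using o(3,4) by (auto simp: under_def underS_def dest: transD antisymD)
  show "\<alpha> \<in> G \<Longrightarrow> \<beta> \<in> G \<Longrightarrow> \<alpha> \<notin> under r \<beta> \<Longrightarrow> \<beta> \<in> underS r \<alpha>"
    using o(2,5) by (cases "\<alpha> = \<beta>") (auto simp: under_def underS_def total_on_def refl_on_def)
qed

lemma agree_on_subset: "agree_on ev B x y \<Longrightarrow> C \<subseteq> B \<Longrightarrow> agree_on ev C x y"
  by (auto simp: agree_on_def)

context function_system
begin

text \<open>Evaluation along such a family maps \<open>K\<close> into a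
  \<open>\<Sigma>\<close>-product of lines, and embeds it if the family separates points.\<close>

definition point_countable_family :: "('k \<Rightarrow> real) set \<Rightarrow> bool"
  where "point_countable_family \<F> \<longleftrightarrow> (\<forall>g\<in>\<F>. continuous_map K euclideanreal g) \<and>
    (\<forall>x\<in>topspace K. countable {g \<in> \<F>. g x \<noteq> 0})"

text \<open>Induction on the cardinality of a set \<open>G\<close> of generators: well-order \<open>G\<close> in its cardinal type
  and glue the families of the initial segments by taking the differences \<open>g - g \<circ> \<rho>\<close>, where \<open>\<rho>\<close> is
  the retraction of the segment strictly below. By countable tightness, a point is moved by only
  countably many steps of the resulting chain of retractions.\<close>

lemma point_countable_separating_family:
  obtains \<F> where "point_countable_family \<F>"
    "\<And>x y. \<lbrakk>x \<in> topspace K; y \<in> topspace K; \<And>g. g \<in> \<F> \<Longrightarrow> g x = g y\<rbrakk> \<Longrightarrow> x = y"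
proof (rule submodel_closure[OF order_refl finite.emptyI])
  let ?U = "topspace K <+> T"
  fix cl :: "('k + 't) set \<Rightarrow> ('k + 't) set"
  assume cl:
    "\<And>G. G \<subseteq> cl G" "\<And>G H. G \<subseteq> H \<Longrightarrow> cl G \<subseteq> cl H" "\<And>G. countable G \<Longrightarrow> countable (cl G)"
    "\<And>G x. x \<in> cl G \<Longrightarrow> \<exists>F. finite F \<and> F \<subseteq> G \<and> x \<in> cl F"
    "\<And>G. G \<subseteq> ?U \<Longrightarrow> cl G \<subseteq> ?U"
    "\<And>G. G \<subseteq> ?U \<Longrightarrow> points_dense (topspace K) ev (Inl -` cl G) (Inr -` cl G)"
    "\<And>G. G \<subseteq> ?U \<Longrightarrow> functions_dense \<C> ev ({} \<union> Inl -` cl G) (Inr -` cl G)"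
  \<comment> \<open>\<open>P G\<close> and \<open>R G\<close> are the points and functions of the
    submodel generated by \<open>G\<close>, and \<open>\<rho> G\<close> retracts \<open>K\<close>
    onto the closure of \<open>P G\<close>.\<close>
  define P where "P G = Inl -` cl G" for G
  define R where "R G = Inr -` cl G" for G
  define \<rho> where "\<rho> G = retr (P G) (R G)" for G
  have P: "P G \<subseteq> topspace K" and R: "R G \<subseteq> T" if "G \<subseteq> ?U" for G
    using cl(5)[OF that] by (auto simp: P_def R_def)
  have dense: "points_dense (topspace K) ev (P G) (R G)" "functions_dense \<C> ev (P G) (R G)"
    if "G \<subseteq> ?U" for G
    using cl(6,7)[OF that] by (simp_all add: P_def R_def)
  have \<rho>: "\<rho> G x \<in> K closure_of P G" "agree_on ev (R G) (\<rho> G x) x" if "G \<subseteq> ?U" "x \<in> topspace K" for G x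
    using retr[OF P R dense(1)] that by (simp_all add: \<rho>_def)
  have \<rho>_eqI: "\<rho> G x = a" if "G \<subseteq> ?U" "x \<in> topspace K" "a \<in> K closure_of P G" "agree_on ev (R G) a x" for G x a
    unfolding \<rho>_def using that by (intro retr_eqI P R dense)
  have \<rho>_cont: "continuous_map K K (\<rho> G)" if "G \<subseteq> ?U" for G
    unfolding \<rho>_def using that by (intro continuous_map_retr P R dense)
  have R_mono: "R G \<subseteq> R H" if "G \<subseteq> H" for G H using cl(2)[OF that] by (auto simp: R_def)

  \<comment> \<open>These are exactly the \<open>\<alpha>\<close> at which the image of
    \<open>x\<close> changes between the retractions of \<open>underS r \<alpha>\<close> and
    \<open>under r \<alpha>\<close>, by \<open>\<rho>_eqI\<close>.\<close>
  have jumps: "countable {\<alpha> \<in> G. \<not> agree_on ev (R (under r \<alpha>)) (\<rho> (underS r \<alpha>) x) x}" (is "countable ?C")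
    if G: "G \<subseteq> ?U" and r: "well_order_on G r" and x: "x \<in> topspace K" for G r x
  proof (rule ccontr)
    note seg = well_order_on_segments[OF r]
    assume unc: "uncountable ?C"
    \<comment> \<open>a shortest initial segment with uncountably many jumps; it has uncountable cofinality\<close>
    obtain I where I: "I \<subseteq> G" "uncountable (?C \<inter> I)" "\<And>\<alpha>. \<alpha> \<in> I \<Longrightarrow> countable (?C \<inter> underS r \<alpha>)"
      "\<And>\<alpha>. \<alpha> \<in> I \<Longrightarrow> under r \<alpha> \<subseteq> I"
    proof (cases "\<exists>\<mu>. \<mu> \<in> {\<mu> \<in> G. uncountable (?C \<inter> underS r \<mu>)}")
      case True
      then obtain \<mu> where "\<mu> \<in> {\<mu> \<in> G. uncountable (?C \<inter> underS r \<mu>)}"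
        and least: "\<forall>\<beta>\<in>underS r \<mu>. \<beta> \<notin> {\<mu> \<in> G. uncountable (?C \<inter> underS r \<mu>)}"
        by (rule exE) (drule well_order_on_least[OF r], erule bexE, rule that)
      then have \<mu>: "uncountable (?C \<inter> underS r \<mu>)" by simp
      show thesis
      proof (rule that)
        show sub: "underS r \<mu> \<subseteq> G" using seg(1,2) by blast
        show "countable (?C \<inter> underS r \<alpha>)" if "\<alpha> \<in> underS r \<mu>" for \<alpha>
          using least[rule_format, OF that] subsetD[OF sub that] by simp
        show "under r \<alpha> \<subseteq> underS r \<mu>" if "\<alpha> \<in> underS r \<mu>" for \<alpha> using seg(4) that .
      qed (rule \<mu>)
    next
      case False
      show thesis
      proof (rule that[OF order_refl])
        have "?C \<inter> G = ?C" by blast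
        then show "uncountable (?C \<inter> G)" using unc by simp
        show "countable (?C \<inter> underS r \<alpha>)" if "\<alpha> \<in> G" for \<alpha>
          using False that by simp
        show "under r \<alpha> \<subseteq> G" for \<alpha> by (rule seg(1))
      qed
    qed
    have IU: "I \<subseteq> ?U" using I(1) G by blast
    define y where "y = \<rho> I x"
    note y = \<rho>[OF IU x, folded y_def]
    obtain A0 where A0: "countable A0" "A0 \<subseteq> P I" "y \<in> K closure_of A0"
      using countable_tightness[OF P[OF IU] y(1)] by blast
    have "\<exists>\<alpha>\<in>I. Inl a \<in> cl (under r \<alpha>)" if "a \<in> A0" for a
    proof -
      have "Inl a \<in> cl I" using A0(2) that by (auto simp: P_def)
      then obtain F where F: "finite F" "F \<subseteq> I" "Inl a \<in> cl F" using cl(4) by blast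
      have "\<exists>\<alpha>\<in>I. F \<subseteq> under r \<alpha>"
      proof (cases "F = {}")
        case True
        have "I \<noteq> {}" using I(2) by auto
        then show ?thesis using True by blast
      next
        case False
        then show ?thesis using well_order_on_finite_bound[OF r F(1) False] F(2) I(1) by blast
      qed
      then show ?thesis using F(3) cl(2) by blast
    qed
    then obtain h where h: "\<And>a. a \<in> A0 \<Longrightarrow> h a \<in> I \<and> Inl a \<in> cl (under r (h a))" by metis
    have "countable (?C \<inter> under r (h a))" if "a \<in> A0" for a
      by (rule countable_subset[of _ "insert (h a) (?C \<inter> underS r (h a))"])
        (use seg(3)[of "h a"] I(3) h[OF that] in auto)
    then have "countable (\<Union>a\<in>A0. ?C \<inter> under r (h a))" using A0(1) by (rule countable_UN[rotated])
    then have "\<not> ?C \<inter> I \<subseteq> (\<Union>a\<in>A0. ?C \<inter> under r (h a))" using I(2) countable_subset by blast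
    \<comment> \<open>Only countably many jumps lie at or below some \<open>h a\<close>, so a jump
      \<open>\<gamma>\<close> in \<open>I\<close> lies beyond all of them. Then \<open>A0\<close> is
      generated strictly below \<open>\<gamma>\<close>, and the retraction there already sends
      \<open>x\<close> to \<open>y\<close>. But \<open>y\<close> agrees with \<open>x\<close> on
      \<open>R I\<close>, so there is no jump at \<open>\<gamma>\<close>.\<close>
    then obtain \<gamma> where \<gamma>: "\<gamma> \<in> ?C" "\<gamma> \<in> I" "\<And>a. a \<in> A0 \<Longrightarrow> \<gamma> \<notin> under r (h a)" by blast
    have uI: "underS r \<gamma> \<subseteq> I" "under r \<gamma> \<subseteq> I" using I(4)[OF \<gamma>(2)] seg(2)[of \<gamma>] by blast+
    then have uU: "underS r \<gamma> \<subseteq> ?U" using IU by blast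
    have "A0 \<subseteq> P (underS r \<gamma>)"
    proof
      fix a assume a: "a \<in> A0"
      have "h a \<in> underS r \<gamma>"
        using seg(5)[of \<gamma> "h a"] \<gamma>(2) \<gamma>(3)[OF a] h[OF a] I(1) by blast
      then have "cl (under r (h a)) \<subseteq> cl (underS r \<gamma>)" by (intro cl(2) seg(4))
      then show "a \<in> P (underS r \<gamma>)" using h[OF a] by (auto simp: P_def)
    qed
    then have "y \<in> K closure_of P (underS r \<gamma>)" using closure_of_mono A0(3) by blast
    then have "\<rho> (underS r \<gamma>) x = y"
      by (rule \<rho>_eqI[OF uU x _ agree_on_subset[OF y(2) R_mono[OF uI(1)]]])
    then show False using \<gamma>(1) agree_on_subset[OF y(2) R_mono[OF uI(2)]] by simp
  qed

  \<comment> \<open>Both directions of the equivalence carry the induction: from right to left it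
    makes the differences vanish away from jumps, from left to right it gives the separation of
    points.\<close>
  have main: "\<exists>\<F>. point_countable_family \<F> \<and>
      (\<forall>x\<in>topspace K. \<forall>y\<in>topspace K. (\<forall>g\<in>\<F>. g x = g y) \<longleftrightarrow> agree_on ev (R G) x y)"
    if "G \<subseteq> ?U" for G
    using wf_inv_image[OF wf_ordLess, of card_of] that
  proof (induction G rule: wf_induct_rule)
    case (less G)
    show ?case
    proof (cases "countable G")
      case True
      have "countable (Inr ` R G :: ('k + 't) set)"
        by (rule countable_subset[OF _ cl(3)[OF True]]) (auto simp: R_def)
      then have "countable (R G)" by (simp add: countable_image_inj_eq)
      then have "countable {g \<in> ev ` R G. g x \<noteq> 0}" for x
        by (rule countable_subset[OF _ countable_image[of "R G" ev], rotated]) auto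
      then have "point_countable_family (ev ` R G)"
        using R[OF less.prems] cont by (auto simp: point_countable_family_def)
      then show ?thesis by (intro exI[of _ "ev ` R G"]) (auto simp: agree_on_def)
    next
      case False
      then have "infinite G" using countable_finite by blast
      then obtain r where r: "well_order_on G r"
        and small: "\<And>\<alpha>. \<alpha> \<in> G \<Longrightarrow> (card_of (under r \<alpha>), card_of G) \<in> ordLess"
        using well_order_small_segments by metis
      note seg = well_order_on_segments[OF r]
      have U: "under r \<alpha> \<subseteq> ?U" "underS r \<alpha> \<subseteq> ?U" for \<alpha> using seg(1,2) less.prems by blast+
      have "\<forall>\<alpha>\<in>G. \<exists>\<F>. point_countable_family \<F> \<and>
          (\<forall>x\<in>topspace K. \<forall>y\<in>topspace K. (\<forall>g\<in>\<F>. g x = g y) \<longleftrightarrow> agree_on ev (R (under r \<alpha>)) x y)"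
      proof
        fix \<alpha> assume "\<alpha> \<in> G"
        then have "(under r \<alpha>, G) \<in> inv_image ordLess card_of" using small by (simp add: inv_image_def)
        then show "\<exists>\<F>. point_countable_family \<F> \<and>
          (\<forall>x\<in>topspace K. \<forall>y\<in>topspace K. (\<forall>g\<in>\<F>. g x = g y) \<longleftrightarrow> agree_on ev (R (under r \<alpha>)) x y)"
          by (rule less.IH[OF _ U(1)])
      qed
      then obtain \<E> where \<E>: "\<And>\<alpha>. \<alpha> \<in> G \<Longrightarrow> point_countable_family (\<E> \<alpha>)"
        "\<And>\<alpha> x y. \<alpha> \<in> G \<Longrightarrow> x \<in> topspace K \<Longrightarrow> y \<in> topspace K \<Longrightarrow>
          (\<forall>g\<in>\<E> \<alpha>. g x = g y) \<longleftrightarrow> agree_on ev (R (under r \<alpha>)) x y" by metis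
      \<comment> \<open>The difference vanishes at \<open>x\<close> unless \<open>\<alpha>\<close>
        is a jump of \<open>x\<close>, so each point meets only countably many of the families
        \<open>\<E> \<alpha>\<close>.\<close>
      define \<delta> where "\<delta> \<alpha> g x = g x - g (\<rho> (underS r \<alpha>) x)" for \<alpha> and g :: "'k \<Rightarrow> real" and x
      \<comment> \<open>\<open>R {}\<close> starts the chain: below the least element of
        \<open>G\<close> the segment is empty, but \<open>R {}\<close> may not be.\<close>
      define \<F> where "\<F> = ev ` R {} \<union> (\<Union>\<alpha>\<in>G. \<delta> \<alpha> ` \<E> \<alpha>)"
      have \<rho>_top: "\<rho> (underS r \<alpha>) x \<in> topspace K" if "x \<in> topspace K" for \<alpha> x
        using \<rho>(1)[OF U(2) that] by (simp add: in_closure_of)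
      have R0: "countable (R {})" "R {} \<subseteq> T"
      proof -
        have "countable (Inr ` R {} :: ('k + 't) set)"
          by (rule countable_subset[OF _ cl(3)[OF countable_empty]]) (auto simp: R_def)
        then show "countable (R {})" by (simp add: countable_image_inj_eq)
      qed (rule R, simp)
      have contF: "continuous_map K euclideanreal g" if g: "g \<in> \<F>" for g
      proof -
        from g consider t where "t \<in> R {}" "g = ev t" | \<alpha> f where "\<alpha> \<in> G" "f \<in> \<E> \<alpha>" "g = \<delta> \<alpha> f"
          by (auto simp: \<F>_def)
        then show ?thesis
        proof cases
          case 2
          then have f: "continuous_map K euclideanreal f"
            using \<E>(1) by (auto simp: point_countable_family_def)
          have "continuous_map K euclideanreal (\<lambda>x. f (\<rho> (underS r \<alpha>) x))"
            using continuous_map_compose[OF \<rho>_cont[OF U(2)] f] by (simp add: o_def)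
          with f show ?thesis unfolding 2(3) \<delta>_def by (intro continuous_map_diff)
        qed (use R0 cont in auto)
      qed
      have cntF: "countable {g \<in> \<F>. g x \<noteq> 0}" if x: "x \<in> topspace K" for x
      proof -
        let ?C = "{\<alpha> \<in> G. \<not> agree_on ev (R (under r \<alpha>)) (\<rho> (underS r \<alpha>) x) x}"
        let ?D = "\<lambda>\<alpha>. {g \<in> \<E> \<alpha>. g x \<noteq> 0} \<union> {g \<in> \<E> \<alpha>. g (\<rho> (underS r \<alpha>) x) \<noteq> 0}"
        have "countable (?D \<alpha>)" if "\<alpha> \<in> G" for \<alpha>
          using \<E>(1)[OF that] x \<rho>_top[OF x] by (simp add: point_countable_family_def)
        then have "countable (\<Union>\<alpha>\<in>?C. \<delta> \<alpha> ` ?D \<alpha>)"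
          by (intro countable_UN jumps[OF less.prems r x] countable_image) simp
        moreover have "{g \<in> \<F>. g x \<noteq> 0} \<subseteq> ev ` R {} \<union> (\<Union>\<alpha>\<in>?C. \<delta> \<alpha> ` ?D \<alpha>)"
        proof
          fix g assume "g \<in> {g \<in> \<F>. g x \<noteq> 0}"
          then consider "g \<in> ev ` R {}" | \<alpha> f where "\<alpha> \<in> G" "f \<in> \<E> \<alpha>" "g = \<delta> \<alpha> f" "\<delta> \<alpha> f x \<noteq> 0"
            by (auto simp: \<F>_def)
          then show "g \<in> ev ` R {} \<union> (\<Union>\<alpha>\<in>?C. \<delta> \<alpha> ` ?D \<alpha>)"
          proof cases
            case 2
            then have ne: "f (\<rho> (underS r \<alpha>) x) \<noteq> f x" by (simp add: \<delta>_def)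
            then have "\<alpha> \<in> ?C" using \<E>(2)[OF 2(1) \<rho>_top[OF x] x] 2(1,2) by blast
            moreover have "f \<in> ?D \<alpha>" using ne 2(2) by auto
            ultimately show ?thesis using 2(3) by blast
          qed simp
        qed
        ultimately show ?thesis using R0(1) by (meson countable_Un countable_image countable_subset)
      qed
      have "(\<forall>g\<in>\<F>. g x = g y) \<longleftrightarrow> agree_on ev (R G) x y" if x: "x \<in> topspace K" and y: "y \<in> topspace K" for x y
      proof
        have \<rho>_same: "\<rho> (underS r \<alpha>) x = \<rho> (underS r \<alpha>) y" if "agree_on ev (R (underS r \<alpha>)) x y" for \<alpha>
          using \<rho>[OF U(2)[of \<alpha>] y] that by (intro \<rho>_eqI[OF U(2) x]) (auto simp: agree_on_def)
        {
          assume ag: "agree_on ev (R G) x y"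
          have sub: "under r \<alpha> \<subseteq> G" "underS r \<alpha> \<subseteq> G" for \<alpha> using seg(1,2) by blast+
          have "g x = g y" if "\<alpha> \<in> G" "g \<in> \<E> \<alpha>" for \<alpha> g
            using \<E>(2)[OF that(1) x y] that(2) agree_on_subset[OF ag R_mono[OF sub(1)]] by blast
          moreover have "\<rho> (underS r \<alpha>) x = \<rho> (underS r \<alpha>) y" for \<alpha>
            by (rule \<rho>_same[OF agree_on_subset[OF ag R_mono[OF sub(2)]]])
          moreover have "ev t x = ev t y" if "t \<in> R {}" for t
            using ag that R_mono[of "{}" G] by (auto simp: agree_on_def)
          ultimately show "\<forall>g\<in>\<F>. g x = g y" by (auto simp: \<F>_def \<delta>_def)
        next
          assume eq: "\<forall>g\<in>\<F>. g x = g y"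
          have R0_eq: "ev t x = ev t y" if "t \<in> R {}" for t
            using eq that by (auto simp: \<F>_def)
          \<comment> \<open>Since \<open>cl\<close> is finitary, a function of \<open>R I\<close> is
            generated by a finite subset of \<open>I\<close>, hence by some
            \<open>under r \<alpha>\<close> with \<open>\<alpha> \<in> I\<close> or by the empty
            set.\<close>
          have extend: "agree_on ev (R I) x y"
            if I: "I \<subseteq> G" "\<And>\<alpha>. \<alpha> \<in> I \<Longrightarrow> agree_on ev (R (under r \<alpha>)) x y" for I
            unfolding agree_on_def
          proof
            fix t assume "t \<in> R I"
            then have "Inr t \<in> cl I" by (simp add: R_def)
            from cl(4)[OF this] obtain F where F: "finite F" "F \<subseteq> I" "t \<in> R F" by (auto simp: R_def)
            show "ev t x = ev t y"
            proof (cases "F = {}")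
              case False
              then obtain \<alpha> where "\<alpha> \<in> F" "F \<subseteq> under r \<alpha>"
                using well_order_on_finite_bound[OF r F(1)] F(2) I(1) by blast
              then have "\<alpha> \<in> I" "t \<in> R (under r \<alpha>)" using F(2,3) R_mono by blast+
              then show ?thesis using I(2) by (simp add: agree_on_def)
            qed (use F R0_eq in simp)
          qed
          \<comment> \<open>At the least failure \<open>\<alpha>\<close> the points agree on
            \<open>R (underS r \<alpha>)\<close>, so they have the same image under that retraction.
            The differences then give equal values of all \<open>g \<in> \<E> \<alpha>\<close>,
            contradicting the failure.\<close>
          show "agree_on ev (R G) x y"
          proof (rule ccontr)
            assume "\<not> agree_on ev (R G) x y"
            then have "\<exists>\<alpha>. \<alpha> \<in> {\<alpha> \<in> G. \<not> agree_on ev (R (under r \<alpha>)) x y}" using extend[OF order_refl] by blast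
            then obtain \<alpha> where "\<alpha> \<in> {\<alpha> \<in> G. \<not> agree_on ev (R (under r \<alpha>)) x y}"
              and least: "\<forall>\<beta>\<in>underS r \<alpha>. \<beta> \<notin> {\<alpha> \<in> G. \<not> agree_on ev (R (under r \<alpha>)) x y}"
              by (rule exE) (drule well_order_on_least[OF r], erule bexE, rule that)
            then have \<alpha>: "\<alpha> \<in> G" "\<not> agree_on ev (R (under r \<alpha>)) x y" by simp_all
            have sub: "underS r \<alpha> \<subseteq> G" using seg(1,2) by blast
            have "agree_on ev (R (underS r \<alpha>)) x y"
            proof (rule extend[OF sub])
              fix \<beta> assume "\<beta> \<in> underS r \<alpha>"
              then show "agree_on ev (R (under r \<beta>)) x y" using least sub by blast
            qed
            then have \<rho>eq: "\<rho> (underS r \<alpha>) x = \<rho> (underS r \<alpha>) y" by (rule \<rho>_same)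
            have "g x = g y" if "g \<in> \<E> \<alpha>" for g
            proof -
              have "\<delta> \<alpha> g \<in> \<F>" using \<alpha>(1) that by (auto simp: \<F>_def)
              then have "\<delta> \<alpha> g x = \<delta> \<alpha> g y" using eq by blast
              then show ?thesis using \<rho>eq by (simp add: \<delta>_def)
            qed
            then show False using \<E>(2)[OF \<alpha>(1) x y] \<alpha>(2) by blast
          qed
        }
      qed
      then show ?thesis
        using contF cntF by (intro exI[of _ \<F>] conjI ballI) (simp_all add: point_countable_family_def)
    qed
  qed
  obtain \<F> where \<F>: "point_countable_family \<F>"
    "\<forall>x\<in>topspace K. \<forall>y\<in>topspace K. (\<forall>g\<in>\<F>. g x = g y) \<longleftrightarrow> agree_on ev (R ?U) x y"
    using main[OF order_refl] by blast
  show thesis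
  proof (rule that[OF \<F>(1)])
    fix x y assume xy: "x \<in> topspace K" "y \<in> topspace K" "\<And>g. g \<in> \<F> \<Longrightarrow> g x = g y"
    then have ag: "agree_on ev (R ?U) x y" using \<F>(2) by blast
    \<comment> \<open>All points are generators here, so \<open>sep\<close> turns agreement on
      \<open>R ?U\<close> into equality.\<close>
    have "topspace K \<subseteq> P ?U" using cl(1)[of ?U] by (auto simp: P_def)
    then have "K closure_of topspace K \<subseteq> K closure_of P ?U" by (rule closure_of_mono)
    then have cl: "x \<in> K closure_of P ?U" "y \<in> K closure_of P ?U" using xy(1,2) by auto
    show "x = y" by (rule sep[OF P R dense(2) cl ag]) simp_all
  qed
qed

text \<open>Every point of the embedded copy has countable support, not just a dense set of
  points.\<close>

lemma Valdivia_compact_K: "Valdivia_compact K"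
proof -
  obtain \<F> where \<F>: "point_countable_family \<F>"
    "\<And>x y. \<lbrakk>x \<in> topspace K; y \<in> topspace K; \<And>g. g \<in> \<F> \<Longrightarrow> g x = g y\<rbrakk> \<Longrightarrow> x = y"
    using point_countable_separating_family by metis
  define e where "e x = restrict (\<lambda>g. g x) \<F>" for x
  define Z where "Z = e ` topspace K"
  have e_cont: "continuous_map K (real_power \<F>) e"
    unfolding continuous_map_componentwise
  proof (intro conjI ballI)
    show "e ` topspace K \<subseteq> extensional \<F>" by (auto simp: e_def)
    fix g assume "g \<in> \<F>"
    then show "continuous_map K euclideanreal (\<lambda>x. e x g)"
      using \<F>(1) by (simp add: e_def point_countable_family_def)
  qed
  have Z: "compactin (real_power \<F>) Z"
    unfolding Z_def using compact e_cont by (intro image_compactin[of K]) (simp_all add: compact_space_def)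
  have tZ: "topspace (subtopology (real_power \<F>) Z) = Z"
    using compactin_subset_topspace[OF Z] by auto
  have "homeomorphic_map K (subtopology (real_power \<F>) Z) e"
  proof (rule continuous_imp_homeomorphic_map)
    show "continuous_map K (subtopology (real_power \<F>) Z) e"
      using e_cont by (simp add: continuous_map_in_subtopology Z_def)
    show "Hausdorff_space (subtopology (real_power \<F>) Z)"
      by (intro Hausdorff_space_subtopology) (simp add: Hausdorff_space_product_topology)
    show "e ` topspace K = topspace (subtopology (real_power \<F>) Z)"
      unfolding tZ by (rule Z_def[symmetric])
    show "inj_on e (topspace K)"
    proof (rule inj_onI)
      fix x y assume "x \<in> topspace K" "y \<in> topspace K" "e x = e y"
      then show "x = y" by (intro \<F>(2)) (auto simp: e_def dest: restrict_cong fun_cong split: if_splits)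
    qed
  qed (rule compact)
  then have "K homeomorphic_space subtopology (real_power \<F>) Z"
    by (rule homeomorphic_map_imp_homeomorphic_space)
  moreover have "subtopology (real_power \<F>) Z closure_of {z \<in> Z. countable {g \<in> \<F>. z g \<noteq> 0}} = Z"
  proof -
    have "{g \<in> \<F>. e x g \<noteq> 0} = {g \<in> \<F>. g x \<noteq> 0}" for x by (auto simp: e_def)
    then have "{z \<in> Z. countable {g \<in> \<F>. z g \<noteq> 0}} = Z"
      using \<F>(1) by (auto simp: Z_def point_countable_family_def)
    then show ?thesis
      using closure_of_topspace[of "subtopology (real_power \<F>) Z"] unfolding tZ by argo
  qed
  ultimately show ?thesis using Z by (intro Valdivia_compactI)
qed

end

section \<open>Compact sets of continuous functions and their restrictions\<close>

lemma topspace_Cp_space: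
  "topspace (Cp_space X) = {f \<in> extensional (topspace X). continuous_map X euclideanreal f}"
  by (auto simp: Cp_space_def PiE_UNIV_domain PiE_def)

lemma continuous_map_evaluation:
  assumes "t \<in> topspace X"
  shows "continuous_map (Cp_space X) euclideanreal (\<lambda>f. f t)"
  unfolding Cp_space_def
  using assms by (intro continuous_map_from_subtopology continuous_map_product_projection)

lemma continuous_map_restriction_map:
  assumes E: "E \<subseteq> topspace X"
  shows "continuous_map (Cp_space X) (Cp_space (subtopology X E)) (restriction_map E)"
proof -
  have tE: "topspace (subtopology X E) = E" using E by auto
  have "continuous_map (Cp_space X) (real_power E) (restriction_map E)"
    unfolding continuous_map_componentwise
  proof (intro conjI ballI)
    show "restriction_map E ` topspace (Cp_space X) \<subseteq> extensional E" by (auto simp: restriction_map_def)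
    fix t assume "t \<in> E"
    then show "continuous_map (Cp_space X) euclideanreal (\<lambda>f. restriction_map E f t)"
      using continuous_map_evaluation[of t X] E by (auto simp: restriction_map_def)
  qed
  moreover have "continuous_map (subtopology X E) euclideanreal (restriction_map E f)"
    if "f \<in> topspace (Cp_space X)" for f
  proof (rule continuous_map_eq)
    show "continuous_map (subtopology X E) euclideanreal f"
      using that by (intro continuous_map_from_subtopology) (simp add: topspace_Cp_space)
  qed (simp add: restriction_map_def)
  ultimately show ?thesis
    unfolding Cp_space_def[of "subtopology X E"] tE by (auto simp: continuous_map_in_subtopology)
qed

text \<open>Countably many functions map \<open>X\<close> into a metrizable space, where distance to
  a missing limit has a continuous reciprocal. This is why the double limit argument first reduces
  to countably many functions.\<close>

lemma bounded_subset_limit_attained: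
  fixes z :: "nat \<Rightarrow> 'a \<Rightarrow> real"
  assumes E: "bounded_subset X E" and z: "\<And>i. continuous_map X euclideanreal (z i)"
    and e: "\<And>n. e n \<in> E" and lim: "\<And>i. (\<lambda>n. z i (e n)) \<longlonglongrightarrow> p i"
  shows "\<exists>w\<in>topspace X. \<forall>i. z i w = p i"
proof (rule ccontr)
  assume no: "\<not> ?thesis"
  \<comment> \<open>otherwise the reciprocal of the distance to \<open>p\<close> in \<open>nat \<Rightarrow> real\<close> is unbounded on \<open>E\<close>\<close>
  define \<Psi> where "\<Psi> w = (\<lambda>i. z i w)" for w
  have \<Psi>: "continuous_map X euclidean \<Psi>"
    using z by (simp add: euclidean_product_topology[symmetric] continuous_map_componentwise_UNIV \<Psi>_def)
  have ne: "dist (\<Psi> w) p \<noteq> 0" if "w \<in> topspace X" for w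
  proof
    assume "dist (\<Psi> w) p = 0"
    then have "\<forall>i. z i w = p i" by (auto simp: \<Psi>_def)
    then show False using no that by blast
  qed
  have "continuous_map X euclideanreal ((\<lambda>v. dist v p) \<circ> \<Psi>)"
    by (rule continuous_map_compose[OF \<Psi>]) (simp add: continuous_on_dist)
  then have "continuous_map X euclideanreal (\<lambda>w. inverse (dist (\<Psi> w) p))"
    using ne by (intro continuous_map_real_inverse) (auto simp: o_def)
  then have "bounded ((\<lambda>w. inverse (dist (\<Psi> w) p)) ` E)"
    using E by (simp add: bounded_subset_def)
  then obtain M where M: "M > 0" "\<And>w. w \<in> E \<Longrightarrow> inverse (dist (\<Psi> w) p) \<le> M"
    unfolding bounded_pos by (auto simp: abs_le_iff)
  have "limitin (product_topology (\<lambda>i. euclideanreal) UNIV) (\<lambda>n. \<Psi> (e n)) p sequentially"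
    using lim by (simp add: limitin_componentwise \<Psi>_def)
  then have "(\<lambda>n. \<Psi> (e n)) \<longlonglongrightarrow> p"
    by (simp add: euclidean_product_topology)
  then have "\<forall>\<^sub>F n in sequentially. dist (\<Psi> (e n)) p < inverse M"
    using M(1) by (intro tendstoD) simp_all
  then obtain n where n: "dist (\<Psi> (e n)) p < inverse M"
    by (meson eventually_sequentially order_refl)
  have "dist (\<Psi> (e n)) p > 0" using ne[of "e n"] e E by (auto simp: bounded_subset_def)
  then have "M < inverse (dist (\<Psi> (e n)) p)" using n M(1)
    by (metis inverse_inverse_eq inverse_less_iff_less positive_imp_inverse_positive)
  then show False using M(2)[OF e[of n]] by simp
qed

section \<open>The compact space of restrictions to \<open>E\<close>, and separation of its
  points\<close>

abbreviation restrictions :: "'a topology \<Rightarrow> 'a set \<Rightarrow> ('a \<Rightarrow> real) set \<Rightarrow> ('a \<Rightarrow> real) topology"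
  where "restrictions X E Y \<equiv> subtopology (Cp_space (subtopology X E)) (restriction_map E ` Y)"

lemma compactin_restrictions:
  assumes "E \<subseteq> topspace X" "compactin (Cp_space X) Y"
  shows "compactin (Cp_space (subtopology X E)) (restriction_map E ` Y)"
  using assms(2) continuous_map_restriction_map[OF assms(1)] by (rule image_compactin)

lemma topspace_restrictions:
  assumes "E \<subseteq> topspace X" "compactin (Cp_space X) Y"
  shows "topspace (restrictions X E Y) = restriction_map E ` Y"
  using compactin_subset_topspace[OF compactin_restrictions[OF assms]] by auto

lemma continuous_map_restrictions_evaluation:
  assumes "E \<subseteq> topspace X" "t \<in> E"
  shows "continuous_map (restrictions X E Y) euclideanreal (\<lambda>f. f t)"
  using assms by (intro continuous_map_from_subtopology continuous_map_evaluation) auto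

text \<open>The points of \<open>E\<close> act by evaluation. Members of the space are extensional,
  so equality at each \<open>t \<in> E\<close> is all that \<open>sep\<close> demands.\<close>

lemma Valdivia_compact_restrictions:
  assumes E: "E \<subseteq> topspace X" and Y: "compactin (Cp_space X) Y"
    and \<C>: "countable \<C>" "\<And>C. C \<in> \<C> \<Longrightarrow> C \<subseteq> E"
    and sep: "\<And>A B x y t. \<lbrakk>A \<subseteq> restriction_map E ` Y; B \<subseteq> E; functions_dense \<C> (\<lambda>t f. f t) A B;
      x \<in> restrictions X E Y closure_of A; y \<in> restrictions X E Y closure_of A;
      agree_on (\<lambda>t f. f t) B x y; t \<in> E\<rbrakk> \<Longrightarrow> x t = y t"
  shows "Valdivia_compact (restrictions X E Y)"
proof -
  have ext: "x \<in> extensional E" if "x \<in> restrictions X E Y closure_of A" for x A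
    using closure_of_subset_topspace[of "restrictions X E Y" A] that E
    by (auto simp: topspace_Cp_space Int_absorb1)
  interpret function_system "restrictions X E Y" E "\<lambda>t f. f t" \<C>
  proof
    show "compact_space (restrictions X E Y)"
      using compactin_restrictions[OF E Y] by (rule compact_space_subtopology)
    show "continuous_map (restrictions X E Y) euclideanreal (\<lambda>f. f t)" if "t \<in> E" for t
      using E that by (rule continuous_map_restrictions_evaluation)
    fix A B x y
    assume *: "A \<subseteq> topspace (restrictions X E Y)" "B \<subseteq> E" "functions_dense \<C> (\<lambda>t f. f t) A B"
      "x \<in> restrictions X E Y closure_of A" "y \<in> restrictions X E Y closure_of A"
      "agree_on (\<lambda>t f. f t) B x y"
    show "x = y"
    proof (rule extensionalityI[OF ext[OF *(4)] ext[OF *(5)]])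
      show "x t = y t" if "t \<in> E" for t
        using sep[OF _ *(2-6) that] *(1) by (simp only: topspace_restrictions[OF E Y])
    qed
  qed (use \<C> in auto)
  show ?thesis by (rule Valdivia_compact_K)
qed

text \<open>A form of Grothendieck's double limit argument: the sequence \<open>e\<close> of points of \<open>E\<close> looks like \<open>t\<close>
  to countably many functions, whose limits \<open>x'\<close> and \<open>y'\<close> agree along \<open>e\<close>; boundedness of \<open>E\<close> yields a
  point \<open>w\<close> of \<open>X\<close> at which all these limits are attained.\<close>

lemma bounded_subset_separation:
  assumes E: "bounded_subset X E" and Y: "compactin (Cp_space X) Y"
    and A: "A \<subseteq> restriction_map E ` Y" and B: "B \<subseteq> E" and dense: "functions_dense {E} (\<lambda>t f. f t) A B"
    and x: "x \<in> restrictions X E Y closure_of A" and y: "y \<in> restrictions X E Y closure_of A"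
    and agree: "agree_on (\<lambda>t f. f t) B x y" and t: "t \<in> E"
  shows "x t = y t"
proof -
  have EX: "E \<subseteq> topspace X" using E by (simp add: bounded_subset_def)
  have YC: "Y \<subseteq> topspace (Cp_space X)" using Y by (rule compactin_subset_topspace)
  have "\<exists>a\<in>A. \<forall>s\<in>insert t F. \<bar>a s - u s\<bar> < inverse (real (Suc n))"
    if "u \<in> restrictions X E Y closure_of A" "finite F" "F \<subseteq> B" for u F n
    using that B t by (intro closure_of_approximation[where f="\<lambda>s a. a s"])
      (auto intro!: continuous_map_restrictions_evaluation[OF EX])
  then obtain a where a: "\<And>u F n. \<lbrakk>u \<in> restrictions X E Y closure_of A; finite F; F \<subseteq> B\<rbrakk> \<Longrightarrow>
      a u F n \<in> A \<and> (\<forall>s\<in>insert t F. \<bar>a u F n s - u s\<bar> < inverse (real (Suc n)))" by metis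
  have "\<exists>b\<in>B. \<forall>f\<in>F. \<bar>f b - f t\<bar> < inverse (real (Suc n))" if "finite F" "F \<subseteq> A" for F n
    using dense t that unfolding functions_dense_def
    by (metis IntD1 inverse_positive_iff_positive of_nat_0_less_iff singletonI zero_less_Suc)
  then obtain b where b: "\<And>F n. \<lbrakk>finite F; F \<subseteq> A\<rbrakk> \<Longrightarrow>
      b F n \<in> B \<and> (\<forall>f\<in>F. \<bar>f (b F n) - f t\<bar> < inverse (real (Suc n)))" by metis
  \<comment> \<open>Closing off under both choices yields a countable \<open>A'\<close> whose
    members approximate \<open>x\<close> and \<open>y\<close> on \<open>insert t B'\<close>, while
    points of \<open>B'\<close> imitate \<open>t\<close> on finite subsets of
    \<open>A'\<close>.\<close>
  define \<Phi> where "\<Phi> P = Inl ` (range (a x (Inr -` P)) \<union> range (a y (Inr -` P))) \<union> Inr ` range (b (Inl -` P))" for P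
  define M where "M = generated \<Phi> {}"
  define A' where "A' = Inl -` M"
  define B' where "B' = Inr -` M"
  have fin: "finite (Inl -` P)" "finite (Inr -` P)" if "finite P" for P :: "(('a \<Rightarrow> real) + 'a) set"
    using that by (auto intro!: finite_vimageI)
  have "M \<subseteq> A <+> B"
    unfolding M_def
  proof (rule generated_least)
    fix P assume P: "finite P" "P \<subseteq> A <+> B"
    then have "Inl -` P \<subseteq> A" "Inr -` P \<subseteq> B" by auto
    then show "\<Phi> P \<subseteq> A <+> B" using a[OF x fin(2)[OF P(1)]] a[OF y fin(2)[OF P(1)]] b[OF fin(1)[OF P(1)]]
      unfolding \<Phi>_def by blast
  qed simp
  then have A': "A' \<subseteq> A" and B': "B' \<subseteq> B" by (auto simp: A'_def B'_def)
  have "countable M"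
    unfolding M_def by (rule countable_generated) (simp_all add: \<Phi>_def)
  have cA': "countable A'"
  proof -
    have "countable (Inl ` A' :: (('a \<Rightarrow> real) + 'a) set)"
      by (rule countable_subset[OF _ \<open>countable M\<close>]) (auto simp: A'_def)
    then show ?thesis by (simp add: countable_image_inj_eq)
  qed
  have aA': "a x F n \<in> A'" "a y F n \<in> A'" if "finite F" "F \<subseteq> B'" for F n
  proof -
    let ?P = "Inr ` F :: (('a \<Rightarrow> real) + 'a) set"
    have "Inr -` ?P = F" by auto
    then have "\<Phi> ?P \<subseteq> M" "Inl (a x F n) \<in> \<Phi> ?P" "Inl (a y F n) \<in> \<Phi> ?P"
      using generated_closed[of ?P \<Phi> "{}"] that by (auto simp: M_def B'_def \<Phi>_def)
    then show "a x F n \<in> A'" "a y F n \<in> A'" by (auto simp: A'_def)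
  qed
  have bB': "b F n \<in> B'" if "finite F" "F \<subseteq> A'" for F n
  proof -
    let ?P = "Inl ` F :: (('a \<Rightarrow> real) + 'a) set"
    have "Inl -` ?P = F" by auto
    then have "\<Phi> ?P \<subseteq> M" "Inr (b F n) \<in> \<Phi> ?P"
      using generated_closed[of ?P \<Phi> "{}"] that by (auto simp: M_def A'_def \<Phi>_def)
    then show "b F n \<in> B'" by (auto simp: B'_def)
  qed
  have ne: "A' \<noteq> {}" using aA'(1)[of "{}"] by auto
  \<comment> \<open>The enumeration repeats values if \<open>A'\<close> is finite.\<close>
  define \<alpha> where "\<alpha> = from_nat_into A'"
  have \<alpha>: "\<alpha> i \<in> A'" "range \<alpha> = A'" for i
    using ne cA' by (simp_all add: \<alpha>_def from_nat_into range_from_nat_into)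

  \<comment> \<open>Boundedness of \<open>E\<close> concerns functions continuous on all of
    \<open>X\<close>, and the point \<open>w\<close> below may lie outside \<open>E\<close>; so the
    functions are lifted back to \<open>Y\<close>.\<close>
  have "\<forall>f\<in>A. \<exists>g\<in>Y. restriction_map E g = f" using A by blast
  then obtain l where l: "\<And>f. f \<in> A \<Longrightarrow> l f \<in> Y \<and> restriction_map E (l f) = f" by metis
  have lval: "l f s = f s" if "f \<in> A" "s \<in> E" for f s
    using l[OF that(1)] that(2) by (metis restriction_map_def restrict_apply')
  let ?CY = "subtopology (Cp_space X) Y"
  have tCY: "topspace ?CY = Y" using YC by auto
  have evCY: "continuous_map ?CY euclideanreal (\<lambda>f. f s)" if "s \<in> topspace X" for s
    using that by (intro continuous_map_from_subtopology continuous_map_evaluation)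
  have lA'Y: "l ` A' \<subseteq> Y" using l A' by blast
  have lift: "\<exists>u'\<in>?CY closure_of (l ` A'). \<forall>s\<in>insert t B'. u' s = u s"
    if u: "u \<in> restrictions X E Y closure_of A"
      and au: "\<And>F n. finite F \<Longrightarrow> F \<subseteq> B' \<Longrightarrow> a u F n \<in> A'" for u
  proof (rule compact_value_lifting[where f="\<lambda>s f. f s" and K="?CY" and A="l ` A'"])
    show "compact_space ?CY" using Y by (rule compact_space_subtopology)
    show "continuous_map ?CY euclideanreal (\<lambda>f. f s)" if "s \<in> insert t B'" for s
      using that t B B' EX by (intro evCY) blast
    show "l ` A' \<subseteq> ?CY closure_of (l ` A')" using lA'Y by (intro closure_of_subset) (simp only: tCY)
    show "closedin ?CY (?CY closure_of (l ` A'))" by simp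
    fix F and \<epsilon> :: real assume F: "finite F" "F \<subseteq> insert t B'" "\<epsilon> > 0"
    obtain n where n: "inverse (real (Suc n)) < \<epsilon>" using reals_Archimedean[OF F(3)] by blast
    let ?F = "F - {t}"
    have F': "finite ?F" "?F \<subseteq> B'" using F by auto
    let ?f = "a u ?F n"
    have f: "?f \<in> A'" "?f \<in> A" using au[OF F'] A' by auto
    have "\<bar>l ?f s - u s\<bar> < \<epsilon>" if "s \<in> F" for s
    proof -
      have "s \<in> insert t ?F" using that by blast
      then have "\<bar>?f s - u s\<bar> < inverse (real (Suc n))" using a[OF u F'(1)] F'(2) B' by blast
      moreover have "s \<in> E" using that F(2) t B B' by blast
      ultimately show ?thesis using n lval[OF f(2)] by simp
    qed
    with f(1) show "\<exists>f\<in>l ` A'. \<forall>s\<in>F. \<bar>f s - u s\<bar> < \<epsilon>" by blast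
  qed
  obtain x' where x': "x' \<in> ?CY closure_of (l ` A')" "\<forall>s\<in>insert t B'. x' s = x s"
    using lift[OF x aA'(1)] by blast
  obtain y' where y': "y' \<in> ?CY closure_of (l ` A')" "\<forall>s\<in>insert t B'. y' s = y s"
    using lift[OF y aA'(2)] by blast

  \<comment> \<open>\<open>e n\<close> imitates \<open>t\<close> on the first \<open>n + 1\<close>
    functions with error below \<open>1/(n + 1)\<close>; as a member of \<open>B'\<close> it does
    not distinguish \<open>x'\<close> from \<open>y'\<close>.\<close>
  define e where "e n = b (\<alpha> ` {..n}) n" for n
  have sub: "\<alpha> ` {..n} \<subseteq> A'" for n using \<alpha>(1) by blast
  have eB': "e n \<in> B'" for n unfolding e_def by (intro bB' sub) simp
  then have eE: "e n \<in> E" for n using B B' by blast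
  have cont: "continuous_map X euclideanreal f" if "f \<in> Y" for f
    using that YC by (auto simp: topspace_Cp_space)
  have x'Y: "x' \<in> Y" and y'Y: "y' \<in> Y"
    using x'(1) y'(1) closure_of_subset_topspace[of ?CY "l ` A'"] unfolding tCY by blast+
  have conv: "(\<lambda>n. l (\<alpha> i) (e n)) \<longlonglongrightarrow> \<alpha> i t" for i
  proof (rule LIMSEQ_I)
    fix r :: real assume "r > 0"
    then obtain N where N: "inverse (real (Suc N)) < r" using reals_Archimedean by blast
    have "\<bar>l (\<alpha> i) (e n) - \<alpha> i t\<bar> < r" if n: "n \<ge> max i N" for n
    proof -
      have "\<alpha> i \<in> \<alpha> ` {..n}" using n by simp
      then have "\<bar>\<alpha> i (e n) - \<alpha> i t\<bar> < inverse (real (Suc n))"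
        using b[of "\<alpha> ` {..n}" n] sub[of n] A' unfolding e_def by blast
      also have "\<dots> \<le> inverse (real (Suc N))" using n by (intro le_imp_inverse_le) auto
      finally show ?thesis using N lval[OF subsetD[OF A' \<alpha>(1)] eE] by simp
    qed
    then show "\<exists>N. \<forall>n\<ge>N. norm (l (\<alpha> i) (e n) - \<alpha> i t) < r" unfolding real_norm_def by blast
  qed
  have "bounded (x' ` E)" using E cont[OF x'Y] by (simp add: bounded_subset_def)
  then have "bounded (range (\<lambda>n. x' (e n)))" by (rule bounded_subset) (use eE in auto)
  then obtain q k where k: "strict_mono (k :: nat \<Rightarrow> nat)" "((\<lambda>n. x' (e n)) \<circ> k) \<longlonglongrightarrow> q"
    using bounded_imp_convergent_subsequence by blast
  have xy_e: "y' (e n) = x' (e n)" for n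
    using x'(2) y'(2) eB'[of n] agree B' by (auto simp: agree_on_def)
  \<comment> \<open>\<open>x'\<close> and \<open>y'\<close>, with common limit \<open>q\<close>
    along the subsequence, are put in front of the enumeration, so that one \<open>w\<close> serves
    all of them.\<close>
  define z where "z i = (case i of 0 \<Rightarrow> x' | Suc 0 \<Rightarrow> y' | Suc (Suc j) \<Rightarrow> l (\<alpha> j))" for i
  define p where "p i = (case i of 0 \<Rightarrow> q | Suc 0 \<Rightarrow> q | Suc (Suc j) \<Rightarrow> \<alpha> j t)" for i
  have "\<exists>w\<in>topspace X. \<forall>i. z i w = p i"
  proof (rule bounded_subset_limit_attained[OF E])
    show "continuous_map X euclideanreal (z i)" for i
      using x'Y y'Y lA'Y \<alpha>(1) by (auto simp: z_def split: nat.split intro!: cont)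
    show "e (k n) \<in> E" for n by (rule eE)
    show "(\<lambda>n. z i (e (k n))) \<longlonglongrightarrow> p i" for i
      using k(2) LIMSEQ_subseq_LIMSEQ[OF conv k(1)]
      by (auto simp: z_def p_def o_def xy_e split: nat.split)
  qed
  then obtain w where w: "w \<in> topspace X" "\<And>i. z i w = p i" by blast
  \<comment> \<open>The lifted members of \<open>A'\<close> take equal values at \<open>w\<close>
    and \<open>t\<close>, and this passes to their closure, in particular to \<open>x'\<close> and
    \<open>y'\<close>.\<close>
  have limit_at_w: "u w = u t" if u: "u \<in> ?CY closure_of (l ` A')" for u
  proof (rule ccontr)
    assume "u w \<noteq> u t"
    define d where "d = \<bar>u w - u t\<bar>"
    have "d/2 > 0" using \<open>u w \<noteq> u t\<close> by (simp add: d_def)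
    from closure_of_approximation[OF u, of "{w, t}" "\<lambda>s f. f s", OF _ _ this]
    obtain f where f: "f \<in> l ` A'" "\<bar>f w - u w\<bar> < d/2" "\<bar>f t - u t\<bar> < d/2"
      using evCY w(1) t EX by auto
    then obtain i where i: "f = l (\<alpha> i)" using \<alpha>(2) by auto
    have "f w = f t"
      using w(2)[of "Suc (Suc i)"] lval[of "\<alpha> i" t] \<alpha>(1)[of i] A' t i by (auto simp: z_def p_def)
    then have "d \<le> \<bar>f w - u w\<bar> + \<bar>f t - u t\<bar>" unfolding d_def by arith
    then show False using f(2,3) by linarith
  qed
  have "x t = q" using limit_at_w[OF x'(1)] w(2)[of 0] x'(2) by (simp add: z_def p_def)
  moreover have "y t = q" using limit_at_w[OF y'(1)] w(2)[of 1] y'(2) by (simp add: z_def p_def)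
  ultimately show ?thesis by simp
qed

text \<open>If \<open>x t \<noteq> y t\<close>, a point that \<open>A\<close> does not distinguish
  from \<open>t\<close> lies in \<open>W0\<close>. So \<open>W0\<close> and the sets
  \<open>W p\<close> cover the compact set \<open>\<phi> s\<close> containing \<open>t\<close>, and
  a finite subcover absorbs a whole piece around \<open>t\<close>. A point of \<open>B\<close> in
  this piece that is close to \<open>t\<close> avoids every chosen \<open>W p\<close>; it lies in
  \<open>W0\<close>, although \<open>x\<close> and \<open>y\<close> agree on
  \<open>B\<close>.\<close>

lemma K_countably_determined_separation:
  fixes S :: "(nat \<Rightarrow> nat) set"
  assumes EX: "E \<subseteq> topspace X" and Y: "compactin (Cp_space X) Y"
    and \<phi>: "\<And>s. s \<in> S \<Longrightarrow> compactin (subtopology X E) (\<phi> s)"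
    and usc: "\<And>U. openin (subtopology X E) U \<Longrightarrow> openin (top_of_set S) {s \<in> S. \<phi> s \<subseteq> U}"
    and cover: "E = (\<Union>s\<in>S. \<phi> s)"
    and A: "A \<subseteq> restriction_map E ` Y" and B: "B \<subseteq> E"
    and dense: "functions_dense (range (\<lambda>\<sigma>. \<Union>s\<in>{s \<in> S. map s [0..<length \<sigma>] = \<sigma>}. \<phi> s)) (\<lambda>t f. f t) A B"
    and x: "x \<in> restrictions X E Y closure_of A" and y: "y \<in> restrictions X E Y closure_of A"
    and agree: "agree_on (\<lambda>t f. f t) B x y" and t: "t \<in> E"
  shows "x t = y t"
proof (rule ccontr)
  assume neq: "x t \<noteq> y t"
  let ?XE = "subtopology X E"
  have tE: "topspace ?XE = E" using EX by auto
  have ev: "continuous_map (restrictions X E Y) euclideanreal (\<lambda>f. f s)" if "s \<in> E" for s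
    using EX that by (rule continuous_map_restrictions_evaluation)
  have cont: "continuous_map ?XE euclideanreal f" if "f \<in> topspace (restrictions X E Y)" for f
    using that by (auto simp: topspace_Cp_space)
  have contA: "continuous_map ?XE euclideanreal f" if "f \<in> A" for f
    using that A cont unfolding topspace_restrictions[OF EX Y] by blast
  have contxy: "continuous_map ?XE euclideanreal x" "continuous_map ?XE euclideanreal y"
    using cont[OF subsetD[OF closure_of_subset_topspace x]] cont[OF subsetD[OF closure_of_subset_topspace y]] .
  have same: "u v = u t" if u: "u \<in> restrictions X E Y closure_of A" and v: "v \<in> E"
    and agr: "\<And>f. f \<in> A \<Longrightarrow> f v = f t" for u v
  proof (rule ccontr)
    assume "u v \<noteq> u t"
    define d where "d = \<bar>u v - u t\<bar>"
    have "d/2 > 0" using \<open>u v \<noteq> u t\<close> by (simp add: d_def)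
    from closure_of_approximation[OF u, of "{v, t}" "\<lambda>s f. f s", OF _ _ this]
    obtain f where f: "f \<in> A" "\<bar>f v - u v\<bar> < d/2" "\<bar>f t - u t\<bar> < d/2"
      using ev v t by auto
    have "d \<le> \<bar>f v - u v\<bar> + \<bar>f t - u t\<bar>" using agr[OF f(1)] unfolding d_def by arith
    then show False using f(2,3) by linarith
  qed
  obtain s where s: "s \<in> S" "t \<in> \<phi> s" using t cover by blast
  define W where "W p = {v \<in> E. \<bar>fst p v - fst p t\<bar> > snd p}" for p :: "('a \<Rightarrow> real) \<times> real"
  define W0 where "W0 = {v \<in> E. x v \<noteq> y v}"
  have openW: "openin ?XE (W p)" if "p \<in> A \<times> {0<..}" for p
  proof -
    have "open {r. \<bar>r - fst p t\<bar> > snd p}" by (intro open_Collect_less continuous_intros)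
    then have "openin ?XE {v \<in> topspace ?XE. fst p v \<in> {r. \<bar>r - fst p t\<bar> > snd p}}"
      using contA[of "fst p"] that by (intro openin_continuous_map_preimage[of _ euclideanreal]) auto
    then show ?thesis unfolding tE W_def by simp
  qed
  have openW0: "openin ?XE W0"
  proof -
    have "continuous_map ?XE euclideanreal (\<lambda>v. x v - y v)"
      using contxy by (intro continuous_map_diff)
    moreover have "open (- {0::real})" by (rule open_Compl) simp
    ultimately have "openin ?XE {v \<in> topspace ?XE. x v - y v \<in> - {0}}"
      by (intro openin_continuous_map_preimage[of _ euclideanreal]) auto
    then show ?thesis unfolding tE W0_def by simp
  qed
  have "\<phi> s \<subseteq> \<Union>(insert W0 (W ` (A \<times> {0<..})))"
  proof
    fix v assume v: "v \<in> \<phi> s"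
    then have vE: "v \<in> E" using cover s by blast
    show "v \<in> \<Union>(insert W0 (W ` (A \<times> {0<..})))"
    proof (cases "\<forall>f\<in>A. f v = f t")
      case True
      then have "x v = x t" "y v = y t" using same[OF x vE] same[OF y vE] by auto
      then show ?thesis using neq vE by (simp add: W0_def)
    next
      case False
      then obtain f where f: "f \<in> A" "f v \<noteq> f t" by blast
      then have "v \<in> W (f, \<bar>f v - f t\<bar>/2)" using vE by (simp add: W_def)
      moreover have "(f, \<bar>f v - f t\<bar>/2) \<in> A \<times> {0<..}" using f by simp
      ultimately show ?thesis by blast
    qed
  qed
  moreover have "\<forall>U\<in>insert W0 (W ` (A \<times> {0<..})). openin ?XE U" using openW openW0 by blast
  ultimately obtain \<F> where \<F>: "finite \<F>" "\<F> \<subseteq> insert W0 (W ` (A \<times> {0<..}))" "\<phi> s \<subseteq> \<Union>\<F>"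
    using \<phi>[OF s(1)] unfolding compactin_def by meson
  have "finite (\<F> - {W0})" "\<F> - {W0} \<subseteq> W ` (A \<times> {0<..})" using \<F> by auto
  then obtain Q where Q: "Q \<subseteq> A \<times> {0<..}" "finite Q" "\<F> - {W0} = W ` Q"
    using finite_subset_image by metis
  have "openin ?XE (\<Union>\<F>)" using \<F>(2) openW openW0 by blast
  from usc[OF this] obtain H where H: "open H" "{s' \<in> S. \<phi> s' \<subseteq> \<Union>\<F>} = S \<inter> H"
    by (auto simp: openin_open)
  then have "s \<in> H" using s(1) \<F>(3) by blast
  have "openin (product_topology (\<lambda>i. euclidean) UNIV) H" using H(1) by (simp add: open_fun_def)
  from product_topology_open_contains_basis[OF this \<open>s \<in> H\<close>]
  obtain V where V: "s \<in> Pi\<^sub>E UNIV V" "finite {i. V i \<noteq> UNIV}" "Pi\<^sub>E UNIV V \<subseteq> H" by auto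
  obtain n where n: "\<And>i. V i \<noteq> UNIV \<Longrightarrow> i < n"
    using V(2) by (metis (mono_tags) finite_nat_set_iff_bounded mem_Collect_eq)
  \<comment> \<open>A basic neighbourhood of \<open>s\<close> restricts finitely many coordinates,
    so a long enough initial segment of \<open>s\<close> forces the inclusion.\<close>
  have near: "\<phi> s' \<subseteq> \<Union>\<F>" if s': "s' \<in> S" "map s' [0..<n] = map s [0..<n]" for s'
  proof -
    have "s' i \<in> V i" for i
    proof (cases "V i = UNIV")
      case False
      then have "s' i = s i" using s'(2) n[OF False] by simp
      then show ?thesis using V(1) by auto
    qed simp
    then have "s' \<in> H" using V(3) by auto
    then show ?thesis using H(2) s'(1) by blast
  qed
  \<comment> \<open>Approximation of \<open>t\<close> within this error escapes \<open>W p\<close>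
    for all \<open>p \<in> Q\<close>.\<close>
  define \<epsilon> where "\<epsilon> = Min (insert 1 (snd ` Q))"
  have \<epsilon>: "\<epsilon> > 0" "\<And>p. p \<in> Q \<Longrightarrow> \<epsilon> \<le> snd p" using Q by (auto simp: \<epsilon>_def)
  define \<sigma> where "\<sigma> = map s [0..<n]"
  let ?C = "\<Union>s\<in>{s \<in> S. map s [0..<length \<sigma>] = \<sigma>}. \<phi> s"
  have "t \<in> ?C" using s by (auto simp: \<sigma>_def)
  moreover have "finite (fst ` Q) \<and> fst ` Q \<subseteq> A \<and> \<epsilon> > 0" using Q \<epsilon>(1) by auto
  ultimately have "\<exists>b\<in>B \<inter> ?C. \<forall>f\<in>fst ` Q. \<bar>f b - f t\<bar> < \<epsilon>"
    by (rule dense[unfolded functions_dense_def, rule_format, OF rangeI])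
  then obtain b where b: "b \<in> B \<inter> ?C" "\<forall>f\<in>fst ` Q. \<bar>f b - f t\<bar> < \<epsilon>" by (rule bexE)
  obtain s' where "s' \<in> S" "map s' [0..<n] = map s [0..<n]" "b \<in> \<phi> s'" using b(1) by (auto simp: \<sigma>_def)
  then have "b \<in> \<Union>\<F>" using near by blast
  then have "b \<in> W0 \<or> (\<exists>p\<in>Q. b \<in> W p)" using Q(3) by blast
  then show False
  proof
    assume "b \<in> W0"
    then show False using agree b(1) by (auto simp: W0_def agree_on_def)
  next
    assume "\<exists>p\<in>Q. b \<in> W p"
    then obtain p where p: "p \<in> Q" "b \<in> W p" by blast
    then have "\<bar>fst p b - fst p t\<bar> < \<epsilon>" using b(2) by blast
    then show False using p \<epsilon>(2)[OF p(1)] by (simp add: W_def)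
  qed
qed

section \<open>The two systems of sets\<close>

text \<open>Such a \<open>\<phi>\<close> is known as an usco map of \<open>S\<close> onto
  \<open>T\<close>.\<close>

definition compact_valued_cover :: "'a topology \<Rightarrow> (nat \<Rightarrow> nat) set \<Rightarrow> ((nat \<Rightarrow> nat) \<Rightarrow> 'a set) \<Rightarrow> bool"
  where "compact_valued_cover T S \<phi> \<longleftrightarrow> (\<forall>s\<in>S. compactin T (\<phi> s)) \<and>
    (\<forall>U. openin T U \<longrightarrow> openin (top_of_set S) {s \<in> S. \<phi> s \<subseteq> U}) \<and>
    topspace T = (\<Union>s\<in>S. \<phi> s)"

lemma K_countably_determined_iff: "K_countably_determined T \<longleftrightarrow> (\<exists>S \<phi>. compact_valued_cover T S \<phi>)"
  by (simp only: K_countably_determined_def compact_valued_cover_def)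

lemma compact_valued_coverD:
  assumes "compact_valued_cover T S \<phi>"
  shows "s \<in> S \<Longrightarrow> compactin T (\<phi> s)"
    and "openin T U \<Longrightarrow> openin (top_of_set S) {s \<in> S. \<phi> s \<subseteq> U}"
    and "topspace T = (\<Union>s\<in>S. \<phi> s)"
  using assms by (simp_all add: compact_valued_cover_def)

lemma Valdivia_restrictions_bounded: "Valdivia_restrictions X {A. bounded_subset X A}"
  unfolding Valdivia_restrictions_def
proof (intro ballI allI impI)
  fix E Y assume "E \<in> {A. bounded_subset X A}" and Y: "compactin (Cp_space X) Y"
  then have E: "bounded_subset X E" by simp
  then have EX: "E \<subseteq> topspace X" by (simp add: bounded_subset_def)
  show "Valdivia_compact (restrictions X E Y)"
  \<comment> \<open>A single piece suffices for a bounded set.\<close>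
  proof (rule Valdivia_compact_restrictions[OF EX Y])
    show "countable {E}" by simp
  qed (auto intro: bounded_subset_separation[OF E Y])
qed

lemma Valdivia_restrictions_K_countably_determined:
  "Valdivia_restrictions X {A. K_countably_determined_subset X A}"
  unfolding Valdivia_restrictions_def
proof (intro ballI allI impI)
  fix E Y assume "E \<in> {A. K_countably_determined_subset X A}" and Y: "compactin (Cp_space X) Y"
  then have EX: "E \<subseteq> topspace X" and "K_countably_determined (subtopology X E)"
    by (simp_all add: K_countably_determined_subset_def)
  then obtain S \<phi> where \<phi>: "compact_valued_cover (subtopology X E) S \<phi>"
    by (auto simp only: K_countably_determined_iff)
  have cover': "E = (\<Union>s\<in>S. \<phi> s)" using compact_valued_coverD(3)[OF \<phi>] EX by auto
  \<comment> \<open>Finite sequences code a countable base of the Baire space; a piece is the part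
    of \<open>E\<close> covered over the trace of a basic set on \<open>S\<close>.\<close>
  let ?\<C> = "range (\<lambda>\<sigma> :: nat list. \<Union>s\<in>{s \<in> S. map s [0..<length \<sigma>] = \<sigma>}. \<phi> s)"
  show "Valdivia_compact (restrictions X E Y)"
  proof (rule Valdivia_compact_restrictions[OF EX Y])
    show "countable ?\<C>" by simp
    show "C \<subseteq> E" if "C \<in> ?\<C>" for C using that cover' by blast
    show "x t = y t" if "A \<subseteq> restriction_map E ` Y" "B \<subseteq> E" "functions_dense ?\<C> (\<lambda>t f. f t) A B"
      "x \<in> restrictions X E Y closure_of A" "y \<in> restrictions X E Y closure_of A"
      "agree_on (\<lambda>t f. f t) B x y" "t \<in> E" for A B x y t
      by (rule K_countably_determined_separation[OF EX Y compact_valued_coverD(1,2)[OF \<phi>] cover' that])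
  qed
qed

section \<open>Finite unions in the two systems\<close>

lemma bounded_subset_Un:
  "bounded_subset X A \<Longrightarrow> bounded_subset X B \<Longrightarrow> bounded_subset X (A \<union> B)"
  by (auto simp: bounded_subset_def image_Un)

text \<open>The first entry of a sequence serves as a tag: 0 selects \<open>\<phi>\<close>, any
  other value \<open>\<psi>\<close>, and the rest is the parameter. Conditions on the tag are
  clopen, so upper semicontinuity can be checked on both parts separately.\<close>

lemma K_countably_determined_subset_Un:
  assumes A: "K_countably_determined_subset X A" and B: "K_countably_determined_subset X B"
  shows "K_countably_determined_subset X (A \<union> B)"
proof -
  have AX: "A \<subseteq> topspace X" and BX: "B \<subseteq> topspace X"
    using A B by (simp_all add: K_countably_determined_subset_def)
  obtain S \<phi> S' \<psi> where "compact_valued_cover (subtopology X A) S \<phi>" "compact_valued_cover (subtopology X B) S' \<psi>"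
    using A B by (auto simp only: K_countably_determined_subset_def K_countably_determined_iff)
  note \<phi> = compact_valued_coverD[OF this(1)] and \<psi> = compact_valued_coverD[OF this(2)]
  define shift :: "(nat \<Rightarrow> nat) \<Rightarrow> nat \<Rightarrow> nat" where "shift s i = s (Suc i)" for s i
  define R where "R = {s. s 0 = 0 \<and> shift s \<in> S \<or> s 0 \<noteq> 0 \<and> shift s \<in> S'}"
  define \<theta> where "\<theta> s = (if s 0 = 0 then \<phi> (shift s) else \<psi> (shift s))" for s
  have cont_shift: "continuous_on UNIV shift"
    by (rule continuous_on_coordinatewise_then_product) (simp add: shift_def)
  have clopen: "open {s :: nat \<Rightarrow> nat. s 0 \<in> N}" for N
  proof -
    have "open ((\<lambda>s :: nat \<Rightarrow> nat. s 0) -` N)"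
      by (rule open_vimage) (simp_all add: open_discrete)
    then show ?thesis by (simp add: vimage_def)
  qed
  show ?thesis
    unfolding K_countably_determined_subset_def K_countably_determined_iff compact_valued_cover_def
  proof (intro conjI exI[of _ R] exI[of _ \<theta>] ballI allI impI)
    show "A \<union> B \<subseteq> topspace X" using AX BX by blast
    show "compactin (subtopology X (A \<union> B)) (\<theta> s)" if "s \<in> R" for s
      using that \<phi>(1) \<psi>(1) by (auto simp: R_def \<theta>_def compactin_subtopology)
    show "topspace (subtopology X (A \<union> B)) = (\<Union>s\<in>R. \<theta> s)"
    proof -
      have cons: "shift (case_nat k s) = s" for k s by (auto simp: shift_def)
      have "(\<Union>s\<in>R. \<theta> s) = (\<Union>s\<in>S. \<phi> s) \<union> (\<Union>s\<in>S'. \<psi> s)"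
      proof (intro subset_antisym Un_least UN_least)
        show "\<theta> s \<subseteq> (\<Union>s\<in>S. \<phi> s) \<union> (\<Union>s\<in>S'. \<psi> s)" if "s \<in> R" for s
          using that by (auto simp: R_def \<theta>_def)
        show "\<phi> s \<subseteq> (\<Union>s\<in>R. \<theta> s)" if "s \<in> S" for s
          by (rule order_trans[OF _ UN_upper[of "case_nat 0 s"]]) (use that in \<open>auto simp: R_def \<theta>_def cons\<close>)
        show "\<psi> s \<subseteq> (\<Union>s\<in>R. \<theta> s)" if "s \<in> S'" for s
          by (rule order_trans[OF _ UN_upper[of "case_nat 1 s"]]) (use that in \<open>auto simp: R_def \<theta>_def cons\<close>)
      qed
      then show ?thesis using \<phi>(3) \<psi>(3) by auto
    qed
    fix U assume "openin (subtopology X (A \<union> B)) U"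
    then obtain H where H: "openin X H" "U = H \<inter> (A \<union> B)" by (auto simp: openin_subtopology)
    have "openin (subtopology X A) (H \<inter> A)" "openin (subtopology X B) (H \<inter> B)"
      using H(1) by (auto simp: openin_subtopology)
    then obtain V V' where V: "open V" "{s \<in> S. \<phi> s \<subseteq> H \<inter> A} = S \<inter> V"
      and V': "open V'" "{s \<in> S'. \<psi> s \<subseteq> H \<inter> B} = S' \<inter> V'"
      using \<phi>(2) \<psi>(2) by (meson openin_open)
    have \<phi>A: "\<phi> s \<subseteq> A" if "s \<in> S" for s using \<phi>(3) that by auto
    have \<psi>B: "\<psi> s \<subseteq> B" if "s \<in> S'" for s using \<psi>(3) that by auto
    have iff: "\<phi> s \<subseteq> U \<longleftrightarrow> s \<in> V" if "s \<in> S" for s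
      using V(2) \<phi>A[OF that] that H(2) by blast
    have iff': "\<psi> s \<subseteq> U \<longleftrightarrow> s \<in> V'" if "s \<in> S'" for s
      using V'(2) \<psi>B[OF that] that H(2) by blast
    let ?H = "{s. s 0 \<in> {0}} \<inter> shift -` V \<union> {s. s 0 \<in> - {0}} \<inter> shift -` V'"
    have "open ?H"
      by (intro open_Un open_Int clopen open_vimage V(1) V'(1) cont_shift)
    moreover have "{s \<in> R. \<theta> s \<subseteq> U} = R \<inter> ?H"
      using iff iff' by (auto simp: R_def \<theta>_def split: if_splits)
    ultimately show "openin (top_of_set R) {s \<in> R. \<theta> s \<subseteq> U}"
      unfolding openin_open by blast
  qed
qed

lemma closed_under_finite_unionsI:
  assumes "\<And>A B. A \<in> \<P> \<Longrightarrow> B \<in> \<P> \<Longrightarrow> A \<union> B \<in> \<P>"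
  shows "closed_under_finite_unions \<P>"
proof -
  have "\<Union>\<F> \<in> \<P>" if "finite \<F>" "\<F> \<noteq> {}" "\<F> \<subseteq> \<P>" for \<F>
    using that by (induction \<F> rule: finite_ne_induct) (auto intro: assms)
  then show ?thesis by (simp add: closed_under_finite_unions_def)
qed

theorem proposition4p2:
  fixes X :: "'a topology" and \<P> :: "'a set set"
  assumes "\<P> = {A. bounded_subset X A} \<or> \<P> = {A. K_countably_determined_subset X A}"
    and "beta_unfavorable X \<P>"
  shows "beta_v_unfavorable X"
  unfolding beta_v_unfavorable_def
proof (intro exI[of _ \<P>] conjI)
  show "\<P> \<subseteq> Pow (topspace X)"
    using assms(1) by (auto simp: bounded_subset_def K_countably_determined_subset_def)
  show "closed_under_finite_unions \<P>"
    using assms(1) bounded_subset_Un K_countably_determined_subset_Un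
    by (intro closed_under_finite_unionsI) blast
  show "Valdivia_restrictions X \<P>"
    using assms(1) Valdivia_restrictions_bounded Valdivia_restrictions_K_countably_determined by blast
qed (rule assms(2))

end
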